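(* Consider unsplittable, splittable, or unit-demand $k$-MCVRP, where every customer satisfies $d(v)\le k$. Let $V'=\{v\in V: d(v)\le\lfloor k/2\rfloor\}$ and let $T'^*$ be a minimum-cost spanning tree of $H[V'\cup\{o\}]$ with respect to $c$. There is a polynomial-time algorithm that outputs a feasible solution of cost at most $\frac{2}{\lfloor k/2\rfloor+1}\Delta+2c(T'^* )$.
   Context: $k$-MCVRP: an instance consists of a complete undirected graph $G=(V\cup D,E)$ with customers $V$ and depots $D$ ($|D|=m$), a symmetric edge weight $w\ge 0$ satisfying the triangle inequality, demands $d(v)\in\mathbb{Z}_{\ge1}$, and a capacity $k\in\mathbb{Z}_{\ge1}$. A tour is a closed walk starting and ending at the same depot, passing through no other depot, delivering at most $k$ units in total to customers on it. A feasible solution is a collection of tours whose deliveries meet all demands; its cost is the total weight of traversed edges (with multiplicity). Splittable: demand may be split among tours; unsplittable: each customer's demand is delivered by one tour; unit-demand: all $d(v)=1$. Auxiliary graph: $H=(V\cup\{o\},F)$ is the complete graph obtained by replacing all depots by a single new depot $o$, with weights $c(o,v)=\min_{u\in D}w(u,v)$ and $c(v,v')=\min\{c(o,v)+c(o,v'),w(v,v')\}$ for $v,v'\in V$. $\Delta\coloneqq\sum_{v\in V}d(v)\,c(o,v)$. For a subset $S$ of vertices, $H[S]$ is the induced subgraph, and $c$ of a set of edges is their total weight. *)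

theory Defs
  imports
    Complex_Main
    "HOL-Library.Discrete_Functions"
    "HOL-Computational_Algebra.Polynomial"
begin

section \<open>Multidepot capacitated vehicle routing\<close>

record 'v mcvrp =
  customers :: "'v set"
  depots :: "'v set"
  weight :: "'v \<Rightarrow> 'v \<Rightarrow> real"
  demand :: "'v \<Rightarrow> nat"
  capacity :: nat

datatype problem_variant = Unsplittable | Splittable | Unit_Demand

abbreviation vertices :: "('v, 'b) mcvrp_scheme \<Rightarrow> 'v set" where
  "vertices I \<equiv> customers I \<union> depots I"

text \<open>
  The graph is complete and simple, so its edges are the pairs of distinct vertices and
  \<open>weight\<close> is meaningful off the diagonal only; the diagonal is fixed to 0.
\<close>

definition mcvrp_instance :: "'v mcvrp \<Rightarrow> bool" where
  "mcvrp_instance I \<longleftrightarrow>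
     finite (customers I) \<and> finite (depots I) \<and> depots I \<noteq> {} \<and>
     customers I \<inter> depots I = {} \<and>
     (\<forall>x\<in>vertices I. weight I x x = 0) \<and>
     (\<forall>x\<in>vertices I. \<forall>y\<in>vertices I. weight I x y = weight I y x) \<and>
     (\<forall>x\<in>vertices I. \<forall>y\<in>vertices I. 0 \<le> weight I x y) \<and>
     (\<forall>x\<in>vertices I. \<forall>y\<in>vertices I. \<forall>z\<in>vertices I.
        weight I x z \<le> weight I x y + weight I y z) \<and>
     (\<forall>v\<in>customers I. 1 \<le> demand I v) \<and>
     1 \<le> capacity I"

definition variant_instance :: "problem_variant \<Rightarrow> 'v mcvrp \<Rightarrow> bool" where
  "variant_instance \<nu> I \<longleftrightarrow>
     mcvrp_instance I \<and> (\<nu> = Unit_Demand \<longrightarrow> (\<forall>v\<in>customers I. demand I v = 1))"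

text \<open>
  A walk is given by its vertex sequence, the depot being both first and last entry;
  \<open>deliver \<tau> v\<close> is the number of units that \<open>\<tau>\<close> brings to \<open>v\<close>.
\<close>

record 'v tour =
  walk :: "'v list"
  deliver :: "'v \<Rightarrow> nat"

definition is_tour :: "'v mcvrp \<Rightarrow> 'v tour \<Rightarrow> bool" where
  "is_tour I \<tau> \<longleftrightarrow>
     walk \<tau> \<noteq> [] \<and> hd (walk \<tau>) \<in> depots I \<and> last (walk \<tau>) = hd (walk \<tau>) \<and>
     set (walk \<tau>) \<subseteq> customers I \<union> {hd (walk \<tau>)} \<and>
     successively (\<noteq>) (walk \<tau>) \<and>
     (\<forall>v. deliver \<tau> v \<noteq> 0 \<longrightarrow> v \<in> customers I \<and> v \<in> set (walk \<tau>)) \<and>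
     (\<Sum>v\<in>customers I. deliver \<tau> v) \<le> capacity I"

definition feasible :: "problem_variant \<Rightarrow> 'v mcvrp \<Rightarrow> 'v tour list \<Rightarrow> bool" where
  "feasible \<nu> I sol \<longleftrightarrow>
     (\<forall>\<tau>\<in>set sol. is_tour I \<tau>) \<and>
     (\<forall>v\<in>customers I. (\<Sum>\<tau>\<leftarrow>sol. deliver \<tau> v) = demand I v) \<and>
     (\<nu> = Unsplittable \<longrightarrow> (\<forall>v\<in>customers I. \<exists>\<tau>\<in>set sol. deliver \<tau> v = demand I v))"

definition walk_cost :: "'v mcvrp \<Rightarrow> 'v list \<Rightarrow> real" where
  "walk_cost I p = (\<Sum>i<length p - 1. weight I (p ! i) (p ! Suc i))"

definition solution_cost :: "'v mcvrp \<Rightarrow> 'v tour list \<Rightarrow> real" where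
  "solution_cost I sol = (\<Sum>\<tau>\<leftarrow>sol. walk_cost I (walk \<tau>))"

section \<open>The auxiliary graph \<open>H\<close>\<close>

text \<open>The merged depot \<open>o\<close> is \<open>None\<close>, a customer \<open>v\<close> is \<open>Some v\<close>.\<close>

definition depot_dist :: "'v mcvrp \<Rightarrow> 'v \<Rightarrow> real" where
  "depot_dist I v = Min ((\<lambda>u. weight I u v) ` depots I)"

fun aux_weight :: "'v mcvrp \<Rightarrow> 'v option \<Rightarrow> 'v option \<Rightarrow> real" where
  "aux_weight I None None = 0"
| "aux_weight I None (Some v) = depot_dist I v"
| "aux_weight I (Some v) None = depot_dist I v"
| "aux_weight I (Some v) (Some v') = min (depot_dist I v + depot_dist I v') (weight I v v')"

definition aux_vertices :: "'v mcvrp \<Rightarrow> 'v option set" where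
  "aux_vertices I = insert None (Some ` customers I)"

definition aux_edges :: "'v mcvrp \<Rightarrow> 'v option set set" where
  "aux_edges I = {{x, y} |x y. x \<in> aux_vertices I \<and> y \<in> aux_vertices I \<and> x \<noteq> y}"

definition edges_weight :: "('a \<Rightarrow> 'a \<Rightarrow> real) \<Rightarrow> 'a set set \<Rightarrow> real" where
  "edges_weight c T = (\<Sum>e\<in>T. THE r. \<exists>x y. e = {x, y} \<and> r = c x y)"

definition Delta :: "'v mcvrp \<Rightarrow> real" where
  "Delta I = (\<Sum>v\<in>customers I. real (demand I v) * aux_weight I None (Some v))"

section \<open>Spanning trees of undirected graphs\<close>

definition induced_edges :: "'a set set \<Rightarrow> 'a set \<Rightarrow> 'a set set" where
  "induced_edges E S = {e \<in> E. e \<subseteq> S}"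

definition graph_connected :: "'a set \<Rightarrow> 'a set set \<Rightarrow> bool" where
  "graph_connected S E \<longleftrightarrow> (\<forall>x\<in>S. \<forall>y\<in>S. (x, y) \<in> {(a, b). {a, b} \<in> E}\<^sup>*)"

definition is_cycle :: "'a set set \<Rightarrow> 'a list \<Rightarrow> bool" where
  "is_cycle E p \<longleftrightarrow>
     3 \<le> length p \<and> distinct p \<and> successively (\<lambda>x y. {x, y} \<in> E) p \<and> {last p, hd p} \<in> E"

definition spanning_tree :: "'a set \<Rightarrow> 'a set set \<Rightarrow> 'a set set \<Rightarrow> bool" where
  "spanning_tree S E T \<longleftrightarrow> T \<subseteq> E \<and> graph_connected S T \<and> \<not> (\<exists>p. is_cycle T p)"

definition min_spanning_tree ::
    "('a \<Rightarrow> 'a \<Rightarrow> real) \<Rightarrow> 'a set \<Rightarrow> 'a set set \<Rightarrow> 'a set set \<Rightarrow> bool" where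
  "min_spanning_tree c S E T \<longleftrightarrow>
     spanning_tree S E T \<and>
     (\<forall>T'. spanning_tree S E T' \<longrightarrow> edges_weight c T \<le> edges_weight c T')"

definition small_customers :: "'v mcvrp \<Rightarrow> 'v set" where
  "small_customers I = {v \<in> customers I. demand I v \<le> capacity I div 2}"

definition small_min_spanning_tree :: "'v mcvrp \<Rightarrow> 'v option set set \<Rightarrow> bool" where
  "small_min_spanning_tree I T \<longleftrightarrow>
     (let S = insert None (Some ` small_customers I)
      in min_spanning_tree (aux_weight I) S (induced_edges (aux_edges I) S) T)"

section \<open>Algorithms and running time\<close>

text \<open>
  Edge weights are real numbers, so algorithms are programs of a random access machine whose
  memory has natural number cells and real number cells (all initially 0 except for the input).
  A cell is addressed by an array name and two indices. The available arithmetic is addition,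
  (truncated) subtraction and comparison, at unit cost. There is no multiplication, so the
  bit length of natural numbers grows by at most a constant per step, and for rational weights
  the uniform cost measure is polynomially related to Turing machine time.
  An expression is charged together with the command that evaluates it: the size of the
  expressions is bounded by a constant of the program.
\<close>

record state =
  nmem :: "nat \<times> nat \<times> nat \<Rightarrow> nat"
  rmem :: "nat \<times> nat \<times> nat \<Rightarrow> real"

datatype nexp = NConst nat | NCell nat nexp nexp | NAdd nexp nexp | NSub nexp nexp
datatype rexp = RCell nat nexp nexp | RAdd rexp rexp | RSub rexp rexp
datatype bexp = NLess nexp nexp | RLess rexp rexp | BNot bexp | BAnd bexp bexp

datatype com =
    Skip
  | NAssign nat nexp nexp nexp
  | RAssign nat nexp nexp rexp
  | Seq com com
  | Cond bexp com com
  | While bexp com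

fun nval :: "nexp \<Rightarrow> state \<Rightarrow> nat" where
  "nval (NConst n) s = n"
| "nval (NCell a i j) s = nmem s (a, nval i s, nval j s)"
| "nval (NAdd e e') s = nval e s + nval e' s"
| "nval (NSub e e') s = nval e s - nval e' s"

fun rval :: "rexp \<Rightarrow> state \<Rightarrow> real" where
  "rval (RCell a i j) s = rmem s (a, nval i s, nval j s)"
| "rval (RAdd e e') s = rval e s + rval e' s"
| "rval (RSub e e') s = rval e s - rval e' s"

fun bval :: "bexp \<Rightarrow> state \<Rightarrow> bool" where
  "bval (NLess e e') s \<longleftrightarrow> nval e s < nval e' s"
| "bval (RLess e e') s \<longleftrightarrow> rval e s < rval e' s"
| "bval (BNot b) s \<longleftrightarrow> \<not> bval b s"
| "bval (BAnd b b') s \<longleftrightarrow> bval b s \<and> bval b' s"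

text \<open>\<open>exec P s t s'\<close>: started in \<open>s\<close>, program \<open>P\<close> halts after \<open>t\<close> steps in \<open>s'\<close>.\<close>

inductive exec :: "com \<Rightarrow> state \<Rightarrow> nat \<Rightarrow> state \<Rightarrow> bool" where
  exec_Skip: "exec Skip s 1 s"
| exec_NAssign:
    "exec (NAssign a i j e) s 1 (s\<lparr>nmem := (nmem s)((a, nval i s, nval j s) := nval e s)\<rparr>)"
| exec_RAssign:
    "exec (RAssign a i j e) s 1 (s\<lparr>rmem := (rmem s)((a, nval i s, nval j s) := rval e s)\<rparr>)"
| exec_Seq: "exec P s t s' \<Longrightarrow> exec Q s' t' s'' \<Longrightarrow> exec (Seq P Q) s (t + t') s''"
| exec_CondTrue: "bval b s \<Longrightarrow> exec P s t s' \<Longrightarrow> exec (Cond b P Q) s (1 + t) s'"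
| exec_CondFalse: "\<not> bval b s \<Longrightarrow> exec Q s t s' \<Longrightarrow> exec (Cond b P Q) s (1 + t) s'"
| exec_WhileFalse: "\<not> bval b s \<Longrightarrow> exec (While b P) s 1 s"
| exec_WhileTrue:
    "bval b s \<Longrightarrow> exec P s t s' \<Longrightarrow> exec (While b P) s' t' s'' \<Longrightarrow>
     exec (While b P) s (1 + t + t') s''"

inductive_cases exec_SkipE: "exec Skip s t s'"
inductive_cases exec_NAssignE: "exec (NAssign a i j e) s t s'"
inductive_cases exec_RAssignE: "exec (RAssign a i j e) s t s'"
inductive_cases exec_SeqE: "exec (Seq P Q) s t s'"
inductive_cases exec_CondE: "exec (Cond b P Q) s t s'"
inductive_cases exec_WhileE: "exec (While b P) s t s'"

lemma exec_deterministic: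
  "exec P s t s' \<Longrightarrow> exec P s u s'' \<Longrightarrow> u = t \<and> s'' = s'"
proof (induction arbitrary: u s'' rule: exec.induct)
  case exec_Skip
  then show ?case by (auto elim: exec_SkipE)
next
  case exec_NAssign
  then show ?case by (auto elim: exec_NAssignE)
next
  case exec_RAssign
  then show ?case by (auto elim: exec_RAssignE)
next
  case exec_Seq
  from exec_Seq.prems show ?case
    by (rule exec_SeqE) (metis exec_Seq.IH)
next
  case exec_CondTrue
  from exec_CondTrue.prems show ?case
    by (rule exec_CondE) (use exec_CondTrue.IH exec_CondTrue.hyps in fastforce)+
next
  case exec_CondFalse
  from exec_CondFalse.prems show ?case
    by (rule exec_CondE) (use exec_CondFalse.IH exec_CondFalse.hyps in fastforce)+
next
  case exec_WhileFalse
  from exec_WhileFalse.prems show ?case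
    by (rule exec_WhileE) (use exec_WhileFalse.hyps in auto)
next
  case exec_WhileTrue
  from exec_WhileTrue.prems show ?case
    by (rule exec_WhileE) (use exec_WhileTrue.IH exec_WhileTrue.hyps in fastforce)+
qed

text \<open>
  A presentation of an instance enumerates the customers as \<open>vs\<close> and the depots as \<open>ds\<close>;
  the program refers to a vertex by its position in \<open>vs @ ds\<close>.
  Input: the numbers of customers and depots and the capacity are in the natural number
  cells \<open>(0,0,0)\<close>, \<open>(0,0,1)\<close>, \<open>(0,0,2)\<close>, the demand of customer \<open>i\<close> is in \<open>(1,i,0)\<close>, and the
  weight between vertices \<open>i\<close> and \<open>j\<close> is in the real number cell \<open>(0,i,j)\<close>.
\<close>

definition presentation :: "'v mcvrp \<Rightarrow> 'v list \<Rightarrow> 'v list \<Rightarrow> bool" where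
  "presentation I vs ds \<longleftrightarrow>
     distinct vs \<and> set vs = customers I \<and> distinct ds \<and> set ds = depots I"

definition input_state :: "'v mcvrp \<Rightarrow> 'v list \<Rightarrow> 'v list \<Rightarrow> state" where
  "input_state I vs ds =
     \<lparr>nmem = (\<lambda>(a, i, j).
        if (a, i, j) = (0, 0, 0) then length vs
        else if (a, i, j) = (0, 0, 1) then length ds
        else if (a, i, j) = (0, 0, 2) then capacity I
        else if a = 1 \<and> i < length vs \<and> j = 0 then demand I (vs ! i)
        else 0),
      rmem = (\<lambda>(a, i, j).
        if a = 0 \<and> i < length (vs @ ds) \<and> j < length (vs @ ds)
        then weight I ((vs @ ds) ! i) ((vs @ ds) ! j)
        else 0)\<rparr>"

text \<open>
  Output: the number of tours is in \<open>(2,0,0)\<close>; for tour number \<open>t\<close>, the length of its vertex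
  sequence is in \<open>(3,t,0)\<close>, the \<open>q\<close>-th vertex of that sequence in \<open>(4,t,q)\<close>, and the amount
  delivered to customer \<open>i\<close> in \<open>(5,t,i)\<close>. A walk is nonempty and does not stay at a vertex, so
  by the initialisation of the cells the size of a feasible output is bounded by the running time.
\<close>

definition outputs :: "state \<Rightarrow> 'v list \<Rightarrow> 'v list \<Rightarrow> 'v tour list \<Rightarrow> bool" where
  "outputs s vs ds sol \<longleftrightarrow>
     length sol = nmem s (2, 0, 0) \<and>
     (\<forall>t<length sol.
        length (walk (sol ! t)) = nmem s (3, t, 0) \<and>
        (\<forall>q<length (walk (sol ! t)).
           nmem s (4, t, q) < length (vs @ ds) \<and>
           walk (sol ! t) ! q = (vs @ ds) ! nmem s (4, t, q)) \<and>
        (\<forall>i<length vs. deliver (sol ! t) (vs ! i) = nmem s (5, t, i)))"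

text \<open>
  Natural numbers are measured by their binary length; each of the weights counts as one unit,
  being a single real number.
\<close>

definition instance_size :: "'v mcvrp \<Rightarrow> nat" where
  "instance_size I =
     (card (vertices I))\<^sup>2 + (\<Sum>v\<in>customers I. floor_log (demand I v) + 1)
     + (floor_log (capacity I) + 1)"

end

theory Submission
  imports Defs
begin

text \<open>
  Grow a tree from the merged depot by Prim's algorithm on the customers with \<open>2 d(v) \<le> k\<close>, with
  edge weights \<open>c(o,v)\<close> and the original \<open>w(v,v')\<close>. Its weight is at most that of a spanning tree
  with respect to \<open>c\<close>: an edge of \<open>c\<close>-weight \<open>c(o,v) + c(o,v')\<close> that leaves the visited set is
  never cheaper than the depot edge of its unvisited end. All edges between customers are thus
  genuine edges of the input graph.

  Process the customers in reverse Prim order, each carrying a bag: a closed walk through it, with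
  the demands that this walk will serve. A processed customer merges its bag into that of its
  parent, along the doubled tree edge. Bags of small customers have load at most \<open>k/2\<close>, so a merged
  bag fits into one vehicle; if its load exceeds \<open>k/2\<close> it is emitted as a tour, and the detour to the
  depot nearest to the walk costs at most \<open>2/(\<lfloor>k/2\<rfloor> + 1)\<close> times the sum of \<open>d(v) c(o,v)\<close> over
  the served customers. A bag at a child of the depot is emitted along the doubled depot edge.
  A large customer is a child of the depot whose bag is already heavy. No demand is ever split.
\<close>


section \<open>Total correctness with step counts\<close>

text \<open>A tour may not visit a depot between its ends, whereas an edge of \<open>H\<close> may
  stand for a route through the depots. For this reason the tree is grown with \<open>w\<close> and
  not with \<open>c\<close>, and its total key is compared with a spanning tree of \<open>H\<close>
  by contracting the visited set, one vertex at a time, instead of exchanging edges. Cost is tracked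
  by one amortised inequality. A small customer pays for its doubled parent edge at the moment it is
  processed; the detour of a heavy bag is paid by the units that leave with it. Large customers pay
  for no edge, so the tree only has to span the small ones. Feasibility rests on an ownership map:
  at any time one slot carries the whole demand of a customer. The final solution is therefore
  unsplit, which serves all three variants at once. Each customer has exactly one tour slot. If
  nothing is emitted while it is processed, the slot receives a trivial tour at a depot, so no
  counter of tours has to be related to the proof. Running time stays polynomial because bag walks
  grow by one entry per merge beyond what they absorb.\<close>

definition runs :: "com \<Rightarrow> state \<Rightarrow> nat \<Rightarrow> (state \<Rightarrow> bool) \<Rightarrow> bool" where
  "runs P s T Q \<longleftrightarrow> (\<exists>t s'. exec P s t s' \<and> t \<le> T \<and> Q s')"

definition set_nat :: "nat \<Rightarrow> nat \<Rightarrow> nat \<Rightarrow> nat \<Rightarrow> state \<Rightarrow> state" where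
  "set_nat a i j x s = s\<lparr>nmem := (nmem s)((a, i, j) := x)\<rparr>"

definition set_real :: "nat \<Rightarrow> nat \<Rightarrow> nat \<Rightarrow> real \<Rightarrow> state \<Rightarrow> state" where
  "set_real a i j x s = s\<lparr>rmem := (rmem s)((a, i, j) := x)\<rparr>"

lemma set_nat_sel [simp]:
  "nmem (set_nat a i j x s) = (nmem s)((a, i, j) := x)" "rmem (set_nat a i j x s) = rmem s"
  by (simp_all add: set_nat_def)

lemma set_real_sel [simp]:
  "rmem (set_real a i j x s) = (rmem s)((a, i, j) := x)" "nmem (set_real a i j x s) = nmem s"
  by (simp_all add: set_real_def)

lemma runs_mono: "runs P s T Q \<Longrightarrow> T \<le> T' \<Longrightarrow> (\<And>s'. Q s' \<Longrightarrow> Q' s') \<Longrightarrow> runs P s T' Q'"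
  unfolding runs_def by (meson le_trans)

lemma runs_Skip: "Q s \<Longrightarrow> 1 \<le> T \<Longrightarrow> runs Skip s T Q"
  unfolding runs_def by (meson exec_Skip)

lemma runs_NAssign:
  "Q (set_nat a (nval i s) (nval j s) (nval e s) s) \<Longrightarrow> 1 \<le> T \<Longrightarrow> runs (NAssign a i j e) s T Q"
  unfolding runs_def set_nat_def using exec_NAssign by blast

lemma runs_RAssign:
  "Q (set_real a (nval i s) (nval j s) (rval e s) s) \<Longrightarrow> 1 \<le> T \<Longrightarrow> runs (RAssign a i j e) s T Q"
  unfolding runs_def set_real_def using exec_RAssign by blast

lemma runs_Seq:
  assumes "runs P s T (\<lambda>s'. runs P' s' T' Q)"
  shows "runs (Seq P P') s (T + T') Q"
proof -
  from assms obtain t s' where "exec P s t s'" "t \<le> T" "runs P' s' T' Q"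
    unfolding runs_def by blast
  moreover from this obtain t' s'' where "exec P' s' t' s''" "t' \<le> T'" "Q s''"
    unfolding runs_def by blast
  ultimately show ?thesis
    unfolding runs_def by (meson exec_Seq add_mono)
qed

text \<open>\<open>Seq\<close> itself costs nothing, so a leading assignment adds exactly one step.
  In this form straight-line code is executed symbolically by repeated introduction.\<close>

lemma runs_Seq_NAssign:
  "runs P (set_nat a (nval i s) (nval j s) (nval e s) s) T Q
    \<Longrightarrow> runs (Seq (NAssign a i j e) P) s (Suc T) Q"
  using runs_Seq[of "NAssign a i j e" s 1 P T Q] by (simp add: runs_NAssign)

lemma runs_Seq_RAssign:
  "runs P (set_real a (nval i s) (nval j s) (rval e s) s) T Q
    \<Longrightarrow> runs (Seq (RAssign a i j e) P) s (Suc T) Q"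
  using runs_Seq[of "RAssign a i j e" s 1 P T Q] by (simp add: runs_RAssign)

lemma runs_Cond:
  assumes "bval b s \<Longrightarrow> runs P s T Q" "\<not> bval b s \<Longrightarrow> runs P' s T Q"
  shows "runs (Cond b P P') s (Suc T) Q"
proof (cases "bval b s")
  case True
  then obtain t s' where "exec P s t s'" "t \<le> T" "Q s'"
    using assms unfolding runs_def by blast
  then show ?thesis
    using True exec_CondTrue unfolding runs_def by (metis Suc_le_mono plus_1_eq_Suc)
next
  case False
  then obtain t s' where "exec P' s t s'" "t \<le> T" "Q s'"
    using assms unfolding runs_def by blast
  then show ?thesis
    using False exec_CondFalse unfolding runs_def by (metis Suc_le_mono plus_1_eq_Suc)
qed

section \<open>Scalar variables and counting loops\<close>

abbreviation Var :: "nat \<Rightarrow> nexp" where "Var x \<equiv> NCell 6 (NConst x) (NConst 0)"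

abbreviation SetVar :: "nat \<Rightarrow> nexp \<Rightarrow> com" where "SetVar x \<equiv> NAssign 6 (NConst x) (NConst 0)"

definition For :: "nat \<Rightarrow> nexp \<Rightarrow> com \<Rightarrow> com" where
  "For x e P = Seq (SetVar x (NConst 0))
     (While (NLess (Var x) e) (Seq P (SetVar x (NAdd (Var x) (NConst 1)))))"

text \<open>The initial assignment and the final failing test cost one step each; an iteration costs
  its test, the body and the increment, hence \<open>T + 2\<close>. The limit \<open>e\<close> is
  evaluated anew at every test, so \<open>bound\<close> has to follow from the invariant.
  \<open>Q i\<close> speaks of states whose counter is already \<open>i\<close>, which is why
  \<open>step\<close> asserts it after the increment.\<close>

lemma runs_For:
  assumes init: "Q 0 (set_nat 6 x 0 0 s)"
    and step: "\<And>i s. i < N \<Longrightarrow> Q i s \<Longrightarrow> nmem s (6, x, 0) = i \<Longrightarrow>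
      runs P s T (\<lambda>s'. nmem s' (6, x, 0) = i \<and> Q (Suc i) (set_nat 6 x 0 (Suc i) s'))"
    and bound: "\<And>i s. i \<le> N \<Longrightarrow> Q i s \<Longrightarrow> nmem s (6, x, 0) = i \<Longrightarrow> nval e s = N"
  shows "runs (For x e P) s (2 + N * (T + 2)) (Q N)"
proof -
  let ?W = "While (NLess (Var x) e) (Seq P (SetVar x (NAdd (Var x) (NConst 1))))"
  have W: "runs ?W s (1 + (N - i) * (T + 2)) (Q N)"
    if "i \<le> N" "Q i s" "nmem s (6, x, 0) = i" for i s
    using that
  proof (induction "N - i" arbitrary: i s)
    case 0
    then have "\<not> bval (NLess (Var x) e) s" using bound[of i s] by simp
    then show ?case
      using 0 unfolding runs_def by (metis exec_WhileFalse diff_is_0_eq le_add1 le_antisym)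
  next
    case (Suc l)
    then have i: "i < N" by simp
    then have b: "bval (NLess (Var x) e) s" using bound[of i s] Suc.prems by simp
    have "runs (Seq P (SetVar x (NAdd (Var x) (NConst 1)))) s (T + 1)
        (\<lambda>s'. Q (Suc i) s' \<and> nmem s' (6, x, 0) = Suc i)"
      by (rule runs_Seq, rule runs_mono[OF step[OF i]])
         (use Suc.prems in \<open>auto intro!: runs_NAssign\<close>)
    then obtain t s' where 1: "exec (Seq P (SetVar x (NAdd (Var x) (NConst 1)))) s t s'"
      "t \<le> T + 1" "Q (Suc i) s'" "nmem s' (6, x, 0) = Suc i"
      unfolding runs_def by blast
    then have "runs ?W s' (1 + (N - Suc i) * (T + 2)) (Q N)"
      using Suc.hyps(1)[of "Suc i" s'] Suc.hyps(2) i by simp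
    then obtain t' s'' where 2: "exec ?W s' t' s''" "t' \<le> 1 + (N - Suc i) * (T + 2)" "Q N s''"
      unfolding runs_def by blast
    have "N - i = Suc (N - Suc i)" using i by simp
    then have "1 + t + t' \<le> 1 + (N - i) * (T + 2)" using 1 2 by simp
    then show ?case
      using exec_WhileTrue[OF b 1(1) 2(1)] 2(3) unfolding runs_def by blast
  qed
  have "runs ?W (set_nat 6 x 0 0 s) (1 + N * (T + 2)) (Q N)"
    using W[of 0 "set_nat 6 x 0 0 s"] init by simp
  then show ?thesis
    unfolding For_def using runs_Seq_NAssign[of ?W 6 "NConst x" s "NConst 0" "NConst 0"] by simp
qed

section \<open>A lower bound for spanning trees\<close>

definition adj :: "'a set set \<Rightarrow> ('a \<times> 'a) set" where
  "adj T = {(a, b). {a, b} \<in> T}"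

lemma adj_rtrancl_sym: "(x, y) \<in> (adj T)\<^sup>* \<Longrightarrow> (y, x) \<in> (adj T)\<^sup>*"
  by (rule symD[OF sym_rtrancl]) (auto simp: adj_def sym_def insert_commute)

text \<open>Cut the path where it enters \<open>A\<close> for the first time. The part before the
  cut has all its vertices outside \<open>A\<close>, so it uses no edge that meets \<open>A\<close>,
  and in particular not the edge through which \<open>A\<close> is entered.\<close>

lemma path_last_entry:
  assumes "(x, a) \<in> (adj T)\<^sup>*" "a \<in> A" "x \<notin> A"
  shows "\<exists>y y'. y \<notin> A \<and> y' \<in> A \<and> {y, y'} \<in> T \<and> (x, y) \<in> (adj (T - {{y, y'}}))\<^sup>*"
proof -
  have "\<exists>y y'. y \<notin> A \<and> y' \<in> A \<and> {y, y'} \<in> T \<and> (x, y) \<in> (adj {e \<in> T. e \<inter> A = {}})\<^sup>*"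
    using assms(1,3)
  proof (induction rule: converse_rtrancl_induct)
    case base
    then show ?case using assms(2) by simp
  next
    case (step x z)
    show ?case
    proof (cases "z \<in> A")
      case True
      then show ?thesis using step by (auto simp: adj_def)
    next
      case False
      then obtain y y' where y: "y \<notin> A" "y' \<in> A" "{y, y'} \<in> T"
        "(z, y) \<in> (adj {e \<in> T. e \<inter> A = {}})\<^sup>*"
        using step by blast
      have "(x, z) \<in> adj {e \<in> T. e \<inter> A = {}}"
        using step False by (auto simp: adj_def)
      then show ?thesis using y by (meson converse_rtrancl_into_rtrancl)
    qed
  qed
  then obtain y y' where y: "y \<notin> A" "y' \<in> A" "{y, y'} \<in> T"
    "(x, y) \<in> (adj {e \<in> T. e \<inter> A = {}})\<^sup>*" by blast
  moreover have "adj {e \<in> T. e \<inter> A = {}} \<subseteq> adj (T - {{y, y'}})"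
    using y by (auto simp: adj_def)
  ultimately show ?thesis using rtrancl_mono by blast
qed

text \<open>
  The visited set \<open>A\<close> is thought of as contracted to a point: removing from \<open>T\<close> the edge through which
  the next vertex reaches it keeps everything connected to the enlarged visited set.
\<close>

lemma greedy_sum_le_connecting_weight:
  fixes f :: "'a \<Rightarrow> real" and c :: "'a set \<Rightarrow> real"
  assumes "finite T" "\<And>e. e \<in> T \<Longrightarrow> 0 \<le> c e" "distinct xs" "set xs \<inter> A = {}"
    "\<And>e. e \<in> T \<Longrightarrow> e \<subseteq> A \<union> set xs"
    "\<And>x. x \<in> set xs \<Longrightarrow> \<exists>a\<in>A. (x, a) \<in> (adj T)\<^sup>*"
    "\<And>pre x post y y'. xs = pre @ x # post \<Longrightarrow> y \<in> set (x # post) \<Longrightarrow> y' \<in> A \<union> set pre \<Longrightarrow>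
        {y, y'} \<in> T \<Longrightarrow> f x \<le> c {y, y'}"
  shows "(\<Sum>x\<in>set xs. f x) \<le> (\<Sum>e\<in>T. c e)"
  using assms
proof (induction xs arbitrary: A T)
  case Nil
  then show ?case by (simp add: sum_nonneg)
next
  case (Cons x xs)
  obtain a where a: "a \<in> A" "(x, a) \<in> (adj T)\<^sup>*"
    using Cons.prems(6)[of x] by auto
  moreover have "x \<notin> A" using Cons.prems(4) by auto
  ultimately obtain y y' where y: "y \<notin> A" "y' \<in> A" "{y, y'} \<in> T"
    "(x, y) \<in> (adj (T - {{y, y'}}))\<^sup>*"
    using path_last_entry by meson
  define T' where "T' = T - {{y, y'}}"
  have "y \<in> set (x # xs)" using Cons.prems(5)[OF y(3)] y(1) by auto
  \<comment> \<open>With the empty prefix, the last hypothesis bounds \<open>f x\<close> by every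
    edge of \<open>T\<close> between the unvisited vertices and \<open>A\<close>; the outer end
    \<open>y\<close> of the chosen edge need not be \<open>x\<close>.\<close>
  then have fx: "f x \<le> c {y, y'}"
    using Cons.prems(7)[of "[]" x xs y y'] y by simp
  \<comment> \<open>Only the removed edge can interrupt a path to \<open>A\<close>. Its end
    \<open>y'\<close> lies in \<open>A\<close>, and its end \<open>y\<close> is still joined to
    \<open>x\<close>, which now counts as visited.\<close>
  have reach: "\<exists>a\<in>insert x A. (z, a) \<in> (adj T')\<^sup>*" if "(z, b) \<in> (adj T)\<^sup>*" "b \<in> A" for z b
    using that
  proof (induction rule: converse_rtrancl_induct)
    case base
    then show ?case by auto
  next
    case (step z z')
    then obtain a' where a': "a' \<in> insert x A" "(z', a') \<in> (adj T')\<^sup>*" by blast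
    show ?case
    proof (cases "{z, z'} = {y, y'}")
      case True
      then have "z = y \<or> z = y'" by (auto simp: doubleton_eq_iff)
      then show ?thesis
        using y(2) adj_rtrancl_sym[OF y(4)] unfolding T'_def by auto
    next
      case False
      then have "(z, z') \<in> adj T'" using step by (auto simp: adj_def T'_def)
      then show ?thesis using a' by (meson converse_rtrancl_into_rtrancl)
    qed
  qed
  have "(\<Sum>x\<in>set xs. f x) \<le> (\<Sum>e\<in>T'. c e)"
  proof (rule Cons.IH[of T' "insert x A"])
    show "f u \<le> c {z, z'}" if "xs = pre @ u # post" "z \<in> set (u # post)"
      "z' \<in> insert x A \<union> set pre" "{z, z'} \<in> T'" for pre u post z z'
      using Cons.prems(7)[of "x # pre" u post z z'] that by (auto simp: T'_def)
    show "\<exists>a\<in>insert x A. (z, a) \<in> (adj T')\<^sup>*" if "z \<in> set xs" for z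
      using Cons.prems(6)[of z] that reach by auto
    show "e \<subseteq> insert x A \<union> set xs" if "e \<in> T'" for e
      using Cons.prems(5)[of e] that by (auto simp: T'_def)
  qed (use Cons.prems in \<open>auto simp: T'_def\<close>)
  moreover have "(\<Sum>e\<in>T. c e) = c {y, y'} + (\<Sum>e\<in>T'. c e)"
    unfolding T'_def using y(3) Cons.prems(1) by (simp add: sum.remove)
  ultimately show ?case using fx Cons.prems(3) by simp
qed

section \<open>Bags and tours\<close>

fun wcost :: "('a \<Rightarrow> 'a \<Rightarrow> real) \<Rightarrow> 'a list \<Rightarrow> real" where
  "wcost w (x # y # zs) = w x y + wcost w (y # zs)"
| "wcost w _ = 0"

lemma wcost_append:
  "xs \<noteq> [] \<Longrightarrow> ys \<noteq> [] \<Longrightarrow> wcost w (xs @ ys) = wcost w xs + w (last xs) (hd ys) + wcost w ys"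
proof (induction w xs rule: wcost.induct)
  case ("2_2" w x)
  then show ?case by (cases ys) auto
qed auto

text \<open>A closed walk stores its base vertex twice. \<open>tl\<close> removes the copy at the
  front, since \<open>drop x l\<close> already ends with it, and \<open>l ! x\<close> becomes the
  repeated vertex instead.\<close>

definition rotate_closed :: "nat \<Rightarrow> 'a list \<Rightarrow> 'a list" where
  "rotate_closed x l = drop x l @ tl (take (Suc x) l)"

lemma length_rotate_closed: "x < length l \<Longrightarrow> length (rotate_closed x l) = length l"
  by (simp add: rotate_closed_def)

text \<open>Running past the end resumes at position 1 and not at 0, as position 0 repeats the last
  entry; this explains the \<open>+ 1\<close>. It is the index computation that the program
  performs.\<close>

lemma nth_rotate_closed:
  assumes "x < length l" "q < length l"
  shows "rotate_closed x l ! q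
    = (if x + q < length l then l ! (x + q) else l ! (x + q + 1 - length l))"
  using assms by (auto simp: rotate_closed_def nth_append nth_tl less_diff_conv add.commute
      intro!: arg_cong[where f = "(!) l"])

lemma rotate_closed_facts:
  assumes x: "x < length l" and closed: "last l = hd l"
  shows "set (rotate_closed x l) = set l" "hd (rotate_closed x l) = l ! x"
    "last (rotate_closed x l) = l ! x"
    "successively (\<noteq>) l \<Longrightarrow> successively (\<noteq>) (rotate_closed x l)"
    "wcost w (rotate_closed x l) = wcost w l"
proof -
  define a where "a = take x l"
  define y where "y = l ! x"
  define b where "b = drop (Suc x) l"
  have l: "l = a @ y # b" unfolding a_def b_def y_def using x by (simp add: id_take_nth_drop)
  define R where "R = rotate_closed x l"
  have r: "R = y # b @ tl (a @ [y])"
    using x by (simp add: R_def rotate_closed_def a_def b_def y_def take_Suc_conv_app_nth Cons_nth_drop_Suc[symmetric])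
  have "set (R) = set l \<and> hd (R) = y \<and> last (R) = y
    \<and> (successively (\<noteq>) l \<longrightarrow> successively (\<noteq>) (R))
    \<and> wcost w (R) = wcost w l"
  proof (cases a)
    case Nil
    then show ?thesis using r l closed by simp
  next
    case (Cons a0 a')
    \<comment> \<open>Closedness identifies the first entry with the last entry of
      \<open>y # b\<close>. The edge that leaves \<open>a0\<close> thus joins the two pieces in the
      rotated order as well, and both lists traverse the same edges.\<close>
    then have a0: "a0 = last (y # b)" using closed l by simp
    have r': "R = (y # b) @ (a' @ [y])" using r Cons by simp
    have l': "l = (a0 # a') @ (y # b)" using l Cons by simp
    have "set (R) = set l"
      unfolding r' l' using a0 last_in_set[of "y # b"] by auto
    moreover have "successively (\<noteq>) (R)" if "successively (\<noteq>) l"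
      using that unfolding r' l' a0
      by (cases a') (auto simp: successively_append_iff successively_Cons hd_append split: if_splits)
    moreover have "wcost w (R) = wcost w l"
    proof (cases a')
      case Nil
      then show ?thesis unfolding r' l' using a0 wcost_append[of "y # b" "[y]" w] by simp
    next
      case (Cons a1 a'')
      then have "wcost w (R)
          = wcost w (y # b) + w a0 a1 + (wcost w a' + w (last a') y)"
        unfolding r' using a0 wcost_append[of "y # b" "a' @ [y]" w] wcost_append[of a' "[y]" w]
        by simp
      moreover have "wcost w l = w a0 a1 + wcost w a' + w (last a') y + wcost w (y # b)"
        unfolding l' using wcost_append[of "a0 # a'" "y # b" w] Cons by simp
      ultimately show ?thesis by simp
    qed
    moreover have "hd R = y" "last R = y" unfolding r' by simp_all
    ultimately show ?thesis by blast
  qed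
  then show "set (rotate_closed x l) = set l" "hd (rotate_closed x l) = l ! x"
    "last (rotate_closed x l) = l ! x"
    "successively (\<noteq>) l \<Longrightarrow> successively (\<noteq>) (rotate_closed x l)"
    "wcost w (rotate_closed x l) = wcost w l"
    by (simp_all add: y_def R_def)
qed

text \<open>All components are indexed by customers. Slot \<open>i\<close> holds the bag of
  \<open>i\<close> while \<open>i\<close> is unprocessed, and the tour written when \<open>i\<close>
  is processed.\<close>

record bags =
  bag_walk :: "nat \<Rightarrow> nat list"
  bag_units :: "nat \<Rightarrow> nat \<Rightarrow> nat"
  bag_load :: "nat \<Rightarrow> nat"
  tour_walk :: "nat \<Rightarrow> nat list"
  tour_units :: "nat \<Rightarrow> nat \<Rightarrow> nat"

definition initial_bags :: "(nat \<Rightarrow> nat) \<Rightarrow> bags" where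
  "initial_bags d = \<lparr>bag_walk = (\<lambda>i. [i]), bag_units = (\<lambda>i j. if i = j then d i else 0),
     bag_load = d, tour_walk = (\<lambda>_. []), tour_units = (\<lambda>_ _. 0)\<rparr>"

text \<open>The final \<open>[r]\<close> closes the walk again, so the edge between \<open>r\<close>
  and \<open>v\<close> is traversed in both directions. The bag of \<open>v\<close> is not cleared;
  it is ignored once \<open>v\<close> has been processed.\<close>

definition merge_bags :: "nat \<Rightarrow> nat \<Rightarrow> bags \<Rightarrow> bags" where
  "merge_bags r v \<sigma> = \<sigma>\<lparr>
     bag_walk := (bag_walk \<sigma>)(r := bag_walk \<sigma> r @ bag_walk \<sigma> v @ [r]),
     bag_units := (bag_units \<sigma>)(r := (\<lambda>j. bag_units \<sigma> r j + bag_units \<sigma> v j)),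
     bag_load := (bag_load \<sigma>)(r := bag_load \<sigma> r + bag_load \<sigma> v)\<rparr>"

definition depot_tour :: "(nat \<Rightarrow> nat) \<Rightarrow> nat \<Rightarrow> nat list \<Rightarrow> nat list" where
  "depot_tour nd x l = nd (l ! x) # rotate_closed x l @ [nd (l ! x)]"

text \<open>Two customers are involved: the bag of \<open>r\<close> is emptied, but the tour goes to
  the slot of the processed customer \<open>v\<close>. If \<open>r\<close> differs from
  \<open>v\<close>, it stays active, and its walk \<open>[r]\<close> can later be joined to the bag
  of its own parent.\<close>

definition emit_bag :: "(nat \<Rightarrow> nat) \<Rightarrow> nat \<Rightarrow> nat \<Rightarrow> nat \<Rightarrow> bags \<Rightarrow> bags" where
  "emit_bag nd x r v \<sigma> = \<sigma>\<lparr>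
     bag_walk := (bag_walk \<sigma>)(r := [r]),
     bag_units := (bag_units \<sigma>)(r := (\<lambda>_. 0)),
     bag_load := (bag_load \<sigma>)(r := 0),
     tour_walk := (tour_walk \<sigma>)(v := depot_tour nd x (bag_walk \<sigma> r)),
     tour_units := (tour_units \<sigma>)(v := bag_units \<sigma> r)\<rparr>"

text \<open>Vertex \<open>n\<close> is the first depot. The walk \<open>[n]\<close> has cost 0 and,
  with the units of the slot still 0, makes a legal tour that fills the slot of a customer whose bag
  lives on in its parent.\<close>

definition keep_bag :: "nat \<Rightarrow> nat \<Rightarrow> bags \<Rightarrow> bags" where
  "keep_bag n v \<sigma> = \<sigma>\<lparr>tour_walk := (tour_walk \<sigma>)(v := [n])\<rparr>"

definition closed_walk :: "nat \<Rightarrow> nat \<Rightarrow> nat list \<Rightarrow> bool" where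
  "closed_walk n u l \<longleftrightarrow>
     l \<noteq> [] \<and> hd l = u \<and> last l = u \<and> set l \<subseteq> {..<n} \<and> successively (\<noteq>) l"

definition bag_ok :: "nat \<Rightarrow> bags \<Rightarrow> nat \<Rightarrow> bool" where
  "bag_ok n \<sigma> u \<longleftrightarrow> closed_walk n u (bag_walk \<sigma> u) \<and>
     (\<forall>j<n. bag_units \<sigma> u j \<noteq> 0 \<longrightarrow> j \<in> set (bag_walk \<sigma> u)) \<and>
     bag_load \<sigma> u = (\<Sum>j<n. bag_units \<sigma> u j)"

definition tour_ok :: "nat \<Rightarrow> nat \<Rightarrow> nat \<Rightarrow> nat list \<Rightarrow> (nat \<Rightarrow> nat) \<Rightarrow> bool" where
  "tour_ok n m k l y \<longleftrightarrow>
     l \<noteq> [] \<and> n \<le> hd l \<and> hd l < n + m \<and> last l = hd l \<and> set l \<subseteq> {..<n} \<union> {hd l} \<and>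
     successively (\<noteq>) l \<and> (\<forall>j<n. y j \<noteq> 0 \<longrightarrow> j \<in> set l) \<and> (\<Sum>j<n. y j) \<le> k"

text \<open>Large customers never receive another bag, so their load stays above \<open>k/2\<close>.\<close>

definition load_ok :: "nat \<Rightarrow> (nat \<Rightarrow> nat) \<Rightarrow> bags \<Rightarrow> nat \<Rightarrow> bool" where
  "load_ok k d \<sigma> u \<longleftrightarrow>
     (if 2 * d u \<le> k then 2 * bag_load \<sigma> u \<le> k
      else k < 2 * bag_load \<sigma> u \<and> bag_load \<sigma> u \<le> k)"

definition current_units :: "nat set \<Rightarrow> bags \<Rightarrow> nat \<Rightarrow> nat \<Rightarrow> nat" where
  "current_units U \<sigma> i = (if i \<in> U then bag_units \<sigma> i else tour_units \<sigma> i)"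

text \<open>\<open>own j\<close> is the single slot that carries the demand of \<open>j\<close>, in
  a bag or in a tour. Merging and emitting only relocate owners, so demands are met exactly and
  without splitting.\<close>

definition units_ok :: "nat \<Rightarrow> (nat \<Rightarrow> nat) \<Rightarrow> nat set \<Rightarrow> bags \<Rightarrow> bool" where
  "units_ok n d U \<sigma> \<longleftrightarrow> (\<exists>own. \<forall>j<n. own j < n \<and>
     (\<forall>i<n. current_units U \<sigma> i j = (if i = own j then d j else 0)))"

text \<open>This is what the bag phase has to know about the tree. A parent precedes its children in
  \<open>ord\<close>, so in the reverse order a customer has received all bags of its children
  before its turn comes. Parent 0 is the depot, customer parents are shifted by one, and edges
  between customers join small ones only.\<close>

locale bag_setup =
  fixes n m k :: nat and d :: "nat \<Rightarrow> nat" and w :: "nat \<Rightarrow> nat \<Rightarrow> real"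
    and dd :: "nat \<Rightarrow> real" and nd :: "nat \<Rightarrow> nat"
    and ord par :: "nat \<Rightarrow> nat" and key :: "nat \<Rightarrow> real"
  assumes d_le: "\<And>i. i < n \<Longrightarrow> d i \<le> k"
    and w_sym: "\<And>i j. i < n + m \<Longrightarrow> j < n + m \<Longrightarrow> w i j = w j i"
    and nd: "\<And>i. i < n \<Longrightarrow> n \<le> nd i \<and> nd i < n + m \<and> w (nd i) i = dd i"
    and dd_nonneg: "\<And>i. i < n \<Longrightarrow> 0 \<le> dd i"
    and m_pos: "0 < m"
    and ord: "bij_betw ord {..<n} {..<n}"
    and par: "\<And>s. s < n \<Longrightarrow> par (ord s) = 0 \<and> key (ord s) = dd (ord s) \<or>
      (\<exists>r<s. par (ord s) = Suc (ord r) \<and> key (ord s) = w (ord r) (ord s) \<and>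
        2 * d (ord r) \<le> k \<and> 2 * d (ord s) \<le> k)"
begin

definition alpha :: real where "alpha = 2 / (real (k div 2) + 1)"

definition best :: "nat \<Rightarrow> nat list \<Rightarrow> bool" where
  "best x l \<longleftrightarrow> x < length l \<and> (\<forall>y\<in>set l. dd (l ! x) \<le> dd y)"

definition units_dist :: "(nat \<Rightarrow> nat) \<Rightarrow> real" where
  "units_dist y = (\<Sum>j<n. real (y j) * dd j)"

text \<open>The amortised balance, with \<open>U\<close> the unprocessed customers. On the left are
  the tours already written and the walks still being built; on the right the doubled keys of
  processed small customers and the share of the units that have left. For full \<open>U\<close> and
  the initial bags both sides are 0; for empty \<open>U\<close> it is the cost bound.\<close>

definition cost_ok :: "nat set \<Rightarrow> bags \<Rightarrow> bool" where
  "cost_ok U \<sigma> \<longleftrightarrow>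
     (\<Sum>t\<in>{..<n} - U. wcost w (tour_walk \<sigma> t)) + (\<Sum>u\<in>U. wcost w (bag_walk \<sigma> u))
     \<le> (\<Sum>t\<in>{..<n} - U. if 2 * d t \<le> k then 2 * key t else 0)
       + alpha * (\<Sum>t\<in>{..<n} - U. units_dist (tour_units \<sigma> t))"

text \<open>The last conjunct is a budget for the running time: a merge creates one additional walk
  entry and removes one active customer, so starting from \<open>n + n\<close> no active walk ever
  exceeds \<open>2 * n\<close> entries.\<close>

definition bag_inv :: "nat set \<Rightarrow> bags \<Rightarrow> bool" where
  "bag_inv U \<sigma> \<longleftrightarrow>
     (\<forall>u\<in>U. bag_ok n \<sigma> u \<and> load_ok k d \<sigma> u \<and> (\<forall>j<n. tour_units \<sigma> u j = 0)) \<and>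
     (\<forall>t\<in>{..<n} - U. tour_ok n m k (tour_walk \<sigma> t) (tour_units \<sigma> t)) \<and>
     units_ok n d U \<sigma> \<and> cost_ok U \<sigma> \<and>
     (\<Sum>u\<in>U. length (bag_walk \<sigma> u)) + card U \<le> 2 * n"

section \<open>Single steps preserve the accounting\<close>

lemma depot_tour:
  assumes l: "closed_walk n u l" and x: "x < length l"
    and y: "\<And>j. j < n \<Longrightarrow> y j \<noteq> 0 \<Longrightarrow> j \<in> set l" "(\<Sum>j<n. y j) \<le> k"
  shows "tour_ok n m k (depot_tour nd x l) y"
    and "wcost w (depot_tour nd x l) = wcost w l + 2 * dd (l ! x)"
proof -
  have c: "last l = hd l" using l by (simp add: closed_walk_def)
  note f = rotate_closed_facts[OF x c]
  have lx: "l ! x < n" using l nth_mem[OF x] unfolding closed_walk_def by blast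
  have ne: "rotate_closed x l \<noteq> []" using length_rotate_closed[OF x] x by auto
  have s: "successively (\<noteq>) (rotate_closed x l)" using f(4) l by (simp add: closed_walk_def)
  show "tour_ok n m k (depot_tour nd x l) y"
  proof -
    have "successively (\<noteq>) (depot_tour nd x l)"
      unfolding depot_tour_def using nd[OF lx] lx s f(2,3) ne
      by (auto simp: successively_append_iff successively_Cons)
    moreover have "set (depot_tour nd x l) = set l \<union> {nd (l ! x)}"
      unfolding depot_tour_def using f(1) by auto
    moreover have "set l \<subseteq> {..<n}" using l by (simp add: closed_walk_def)
    ultimately show ?thesis
      using nd[OF lx] y unfolding tour_ok_def by (auto simp: depot_tour_def)
  qed
  have "w (l ! x) (nd (l ! x)) = dd (l ! x)" "w (nd (l ! x)) (l ! x) = dd (l ! x)"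
    using nd[OF lx] w_sym[of "l ! x" "nd (l ! x)"] lx by auto
  then show "wcost w (depot_tour nd x l) = wcost w l + 2 * dd (l ! x)"
    unfolding depot_tour_def
    using wcost_append[of "[nd (l ! x)]" "rotate_closed x l @ [nd (l ! x)]" w]
      wcost_append[of "rotate_closed x l" "[nd (l ! x)]" w] ne f by simp
qed

text \<open>By integrality, a load above \<open>k/2\<close> has at least \<open>k div 2 + 1\<close>
  units. Each of them belongs to a vertex of the walk and is thus at least as far from the depots as
  \<open>l ! x\<close>. Spreading two depot edges over that many units gives
  \<open>alpha\<close>.\<close>

lemma detour_le_units_dist:
  assumes "best x l" "set l \<subseteq> {..<n}" "\<And>j. j < n \<Longrightarrow> y j \<noteq> 0 \<Longrightarrow> j \<in> set l"
    and "k < 2 * (\<Sum>j<n. y j)"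
  shows "2 * dd (l ! x) \<le> alpha * units_dist y"
proof -
  have "l ! x \<in> set l" using assms(1) by (simp add: best_def)
  then have nn: "0 \<le> dd (l ! x)" using assms(2) dd_nonneg by auto
  have L: "real (k div 2) + 1 \<le> real (\<Sum>j<n. y j)"
  proof -
    have "k div 2 + 1 \<le> (\<Sum>j<n. y j)" using assms(4) by simp
    then show ?thesis by (metis of_nat_1 of_nat_add of_nat_le_iff)
  qed
  have "(real (k div 2) + 1) * dd (l ! x) \<le> real (\<Sum>j<n. y j) * dd (l ! x)"
    using L nn by (rule mult_right_mono)
  also have "\<dots> = (\<Sum>j<n. real (y j) * dd (l ! x))" by (simp add: sum_distrib_right)
  also have "\<dots> \<le> units_dist y"
    unfolding units_dist_def
  proof (rule sum_mono)
    fix j assume "j \<in> {..<n}"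
    then show "real (y j) * dd (l ! x) \<le> real (y j) * dd j"
      using assms(1) assms(3)[of j] by (cases "y j = 0") (auto simp: best_def intro!: mult_left_mono)
  qed
  finally show ?thesis unfolding alpha_def by (simp add: field_simps)
qed

lemma alpha_units_dist_nonneg: "0 \<le> alpha * units_dist y"
  unfolding alpha_def units_dist_def by (intro mult_nonneg_nonneg sum_nonneg) (auto simp: dd_nonneg)

lemma inv_initial: "bag_inv {..<n} (initial_bags d)"
proof -
  have "units_ok n d {..<n} (initial_bags d)"
    unfolding units_ok_def by (rule exI[of _ id]) (auto simp: current_units_def initial_bags_def)
  then show ?thesis
    unfolding bag_inv_def cost_ok_def
    by (auto simp: initial_bags_def bag_ok_def closed_walk_def load_ok_def d_le split: if_splits)
qed

lemma inv_final:
  assumes "bag_inv {} \<sigma>"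
  shows "\<And>t. t < n \<Longrightarrow> tour_ok n m k (tour_walk \<sigma> t) (tour_units \<sigma> t)"
    and "\<exists>own. \<forall>j<n. own j < n \<and> (\<forall>i<n. tour_units \<sigma> i j = (if i = own j then d j else 0))"
    and "(\<Sum>t<n. wcost w (tour_walk \<sigma> t))
      \<le> alpha * (\<Sum>j<n. real (d j) * dd j) + 2 * (\<Sum>t | t < n \<and> 2 * d t \<le> k. key t)"
proof -
  show "\<And>t. t < n \<Longrightarrow> tour_ok n m k (tour_walk \<sigma> t) (tour_units \<sigma> t)"
    using assms by (auto simp: bag_inv_def)
  show "\<exists>own. \<forall>j<n. own j < n \<and> (\<forall>i<n. tour_units \<sigma> i j = (if i = own j then d j else 0))"
    using assms by (auto simp: bag_inv_def units_ok_def current_units_def)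
  then obtain own where own: "\<And>j. j < n \<Longrightarrow> own j < n"
    "\<And>i j. i < n \<Longrightarrow> j < n \<Longrightarrow> tour_units \<sigma> i j = (if i = own j then d j else 0)" by blast
  \<comment> \<open>After exchanging the sums, every customer \<open>j\<close> is seen in its owner
    slot only, there with its full demand.\<close>
  have "(\<Sum>t<n. units_dist (tour_units \<sigma> t)) = (\<Sum>j<n. \<Sum>t<n. real (tour_units \<sigma> t j) * dd j)"
    unfolding units_dist_def by (rule sum.swap)
  also have "\<dots> = (\<Sum>j<n. \<Sum>t<n. if t = own j then real (d j) * dd j else 0)"
    using own by (intro sum.cong) auto
  also have "\<dots> = (\<Sum>j<n. real (d j) * dd j)"
    using own by (intro sum.cong) auto
  finally have u: "(\<Sum>t<n. units_dist (tour_units \<sigma> t)) = (\<Sum>j<n. real (d j) * dd j)" .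
  have "(\<Sum>t<n. if 2 * d t \<le> k then 2 * key t else 0) = 2 * (\<Sum>t | t < n \<and> 2 * d t \<le> k. key t)"
    by (simp add: sum_distrib_left sum.If_cases Collect_conj_eq lessThan_def Int_commute)
  then show "(\<Sum>t<n. wcost w (tour_walk \<sigma> t))
      \<le> alpha * (\<Sum>j<n. real (d j) * dd j) + 2 * (\<Sum>t | t < n \<and> 2 * d t \<le> k. key t)"
    using assms u by (simp add: bag_inv_def cost_ok_def)
qed

lemma inv_root_step:
  assumes inv: "bag_inv U \<sigma>" and U: "U \<subseteq> {..<n}" "v \<in> U" and root: "key v = dd v"
    and x: "best x (bag_walk \<sigma> v)"
  shows "bag_inv (U - {v}) (emit_bag nd x v v \<sigma>)"
proof -
  let ?l = "bag_walk \<sigma> v" and ?U = "U - {v}" and ?\<sigma> = "emit_bag nd x v v \<sigma>"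
  have fin: "finite U" using U finite_subset by blast
  have bag: "closed_walk n v ?l" "\<And>j. j < n \<Longrightarrow> bag_units \<sigma> v j \<noteq> 0 \<Longrightarrow> j \<in> set ?l"
    "bag_load \<sigma> v = (\<Sum>j<n. bag_units \<sigma> v j)" "load_ok k d \<sigma> v"
    using inv U by (auto simp: bag_inv_def bag_ok_def)
  have xl: "x < length ?l" using x by (simp add: best_def)
  have L: "(\<Sum>j<n. bag_units \<sigma> v j) \<le> k"
    using bag(3,4) by (auto simp: load_ok_def split: if_splits)
  note tour = depot_tour[OF bag(1) xl bag(2) L]
  have P: "{..<n} - ?U = insert v ({..<n} - U)" "v \<notin> {..<n} - U" using U by auto
  have price: "2 * dd (?l ! x) \<le> (if 2 * d v \<le> k then 2 * key v else 0) + alpha * units_dist (bag_units \<sigma> v)"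
  proof (cases "2 * d v \<le> k")
    case True
    have "v \<in> set ?l" using bag(1) unfolding closed_walk_def by (metis hd_in_set)
    then have "dd (?l ! x) \<le> dd v" using x by (simp add: best_def)
    then show ?thesis using True root alpha_units_dist_nonneg[of "bag_units \<sigma> v"] by simp
  next
    case False
    then have "k < 2 * (\<Sum>j<n. bag_units \<sigma> v j)" using bag(3,4) by (simp add: load_ok_def)
    then show ?thesis
      using detour_le_units_dist[OF x _ bag(2)] False bag(1) by (simp add: closed_walk_def)
  qed
  have "cost_ok ?U ?\<sigma>"
  proof -
    have "(\<Sum>t\<in>{..<n} - ?U. wcost w (tour_walk ?\<sigma> t))
        = wcost w ?l + 2 * dd (?l ! x) + (\<Sum>t\<in>{..<n} - U. wcost w (tour_walk \<sigma> t))"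
      unfolding P(1) using P(2) tour(2) U(2) by (auto simp: emit_bag_def intro!: sum.cong)
    moreover have "(\<Sum>u\<in>?U. wcost w (bag_walk ?\<sigma> u)) + wcost w ?l = (\<Sum>u\<in>U. wcost w (bag_walk \<sigma> u))"
      using sum.remove[OF fin U(2), of "\<lambda>u. wcost w (bag_walk \<sigma> u)"]
      by (auto simp: emit_bag_def intro!: sum.cong)
    moreover have "(\<Sum>t\<in>{..<n} - ?U. units_dist (tour_units ?\<sigma> t))
        = units_dist (bag_units \<sigma> v) + (\<Sum>t\<in>{..<n} - U. units_dist (tour_units \<sigma> t))"
      unfolding P(1) using P(2) U(2) by (auto simp: emit_bag_def intro!: sum.cong)
    moreover have "(\<Sum>t\<in>{..<n} - ?U. if 2 * d t \<le> k then 2 * key t else 0)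
        = (if 2 * d v \<le> k then 2 * key v else 0) + (\<Sum>t\<in>{..<n} - U. if 2 * d t \<le> k then 2 * key t else 0)"
      unfolding P(1) using P(2) by simp
    moreover have "cost_ok U \<sigma>" using inv by (simp add: bag_inv_def)
    ultimately show ?thesis using price unfolding cost_ok_def by (simp add: distrib_left)
  qed
  moreover have "current_units ?U ?\<sigma> = current_units U \<sigma>"
    using U(2) by (auto simp: current_units_def emit_bag_def)
  then have "units_ok n d ?U ?\<sigma>"
    using inv by (simp add: bag_inv_def units_ok_def)
  moreover have "(\<Sum>u\<in>?U. length (bag_walk ?\<sigma> u)) + card ?U \<le> 2 * n"
  proof -
    have "(\<Sum>u\<in>?U. length (bag_walk ?\<sigma> u)) \<le> (\<Sum>u\<in>U. length (bag_walk \<sigma> u))"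
      using sum.remove[OF fin U(2), of "\<lambda>u. length (bag_walk \<sigma> u)"] by (simp add: emit_bag_def)
    moreover have "card ?U \<le> card U" by (rule card_mono) (use fin in auto)
    ultimately show ?thesis using inv unfolding bag_inv_def by linarith
  qed
  moreover have "\<forall>u\<in>?U. bag_ok n ?\<sigma> u \<and> load_ok k d ?\<sigma> u \<and> (\<forall>j<n. tour_units ?\<sigma> u j = 0)"
    using inv by (auto simp: bag_inv_def bag_ok_def load_ok_def emit_bag_def)
  moreover have "\<forall>t\<in>{..<n} - ?U. tour_ok n m k (tour_walk ?\<sigma> t) (tour_units ?\<sigma> t)"
    unfolding P(1) using inv U(2) tour(1) by (auto simp: bag_inv_def emit_bag_def)
  ultimately show ?thesis unfolding bag_inv_def by blast
qed

section \<open>Merging a processed customer into its parent\<close>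

context
  fixes U \<sigma> v r
  assumes inv: "bag_inv U \<sigma>" and U: "U \<subseteq> {..<n}" "v \<in> U" "r \<in> U" "r \<noteq> v"
    and small: "2 * d r \<le> k" "2 * d v \<le> k" and key: "key v = w r v"
begin

lemma merge_step_sum:
  fixes g :: "nat list \<Rightarrow> 'b :: comm_monoid_add"
  shows "(\<Sum>u\<in>U. g (bag_walk \<sigma> u))
    = g (bag_walk \<sigma> v) + (g (bag_walk \<sigma> r) + (\<Sum>u\<in>U - {v} - {r}. g (bag_walk \<sigma> u)))"
proof -
  have fin: "finite U" using U finite_subset by blast
  show ?thesis
    using sum.remove[OF fin U(2), of "\<lambda>u. g (bag_walk \<sigma> u)"]
      sum.remove[of "U - {v}" r "\<lambda>u. g (bag_walk \<sigma> u)"] fin U by simp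
qed

lemma merge_step_bag:
  shows "bag_ok n (merge_bags r v \<sigma>) r"
    and "wcost w (bag_walk (merge_bags r v \<sigma>) r)
      = wcost w (bag_walk \<sigma> r) + wcost w (bag_walk \<sigma> v) + 2 * key v"
    and "bag_load (merge_bags r v \<sigma>) r \<le> k"
proof -
  let ?r = "bag_walk \<sigma> r" and ?v = "bag_walk \<sigma> v"
  have bag: "bag_ok n \<sigma> r" "bag_ok n \<sigma> v" "load_ok k d \<sigma> r" "load_ok k d \<sigma> v"
    using inv U by (auto simp: bag_inv_def)
  have c: "?r \<noteq> []" "hd ?r = r" "last ?r = r" "?v \<noteq> []" "hd ?v = v" "last ?v = v"
    "set ?r \<subseteq> {..<n}" "set ?v \<subseteq> {..<n}" "successively (\<noteq>) ?r" "successively (\<noteq>) ?v"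
    using bag by (auto simp: bag_ok_def closed_walk_def)
  have rn: "r < n" "v < n" using U by auto
  have "closed_walk n r (?r @ ?v @ [r])"
    using c rn U(4) by (auto simp: closed_walk_def successively_append_iff)
  then show "bag_ok n (merge_bags r v \<sigma>) r"
    using bag by (auto simp: bag_ok_def merge_bags_def sum.distrib)
  show "wcost w (bag_walk (merge_bags r v \<sigma>) r) = wcost w ?r + wcost w ?v + 2 * key v"
    using wcost_append[of ?r "?v @ [r]" w] wcost_append[of ?v "[r]" w] c key w_sym[of v r] rn
    by (simp add: merge_bags_def)
  show "bag_load (merge_bags r v \<sigma>) r \<le> k"
    using bag(3,4) small by (auto simp: load_ok_def merge_bags_def)
qed

lemma tours_insert: "{..<n} - (U - {v}) = insert v ({..<n} - U)" "v \<notin> {..<n} - U"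
  using U by auto

text \<open>No units leave. The walks grow by \<open>2 * key v\<close> in total, which is precisely
  the amount that \<open>v\<close> adds to the right-hand side of the balance when it becomes
  processed.\<close>

lemma inv_keep_step:
  assumes load: "2 * bag_load (merge_bags r v \<sigma>) r \<le> k"
  shows "bag_inv (U - {v}) (keep_bag n v (merge_bags r v \<sigma>))"
proof -
  let ?U = "U - {v}" and ?\<sigma> = "keep_bag n v (merge_bags r v \<sigma>)"
  have fin: "finite U" using U finite_subset by blast
  note P = tours_insert
  have vY: "\<And>j. j < n \<Longrightarrow> tour_units \<sigma> v j = 0" using inv U by (auto simp: bag_inv_def)
  have sumU: "(\<Sum>u\<in>?U. g (bag_walk ?\<sigma> u))
      = g (bag_walk (merge_bags r v \<sigma>) r) + (\<Sum>u\<in>U - {v} - {r}. g (bag_walk \<sigma> u))"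
    for g :: "nat list \<Rightarrow> 'b :: comm_monoid_add"
    using sum.remove[of ?U r "\<lambda>u. g (bag_walk ?\<sigma> u)"] fin U
    by (simp add: keep_bag_def merge_bags_def)
  have "cost_ok ?U ?\<sigma>"
  proof -
    have "(\<Sum>t\<in>{..<n} - ?U. wcost w (tour_walk ?\<sigma> t)) = (\<Sum>t\<in>{..<n} - U. wcost w (tour_walk \<sigma> t))"
      unfolding P(1) using P(2) U(2) by (auto simp: keep_bag_def merge_bags_def intro!: sum.cong)
    moreover have "(\<Sum>u\<in>?U. wcost w (bag_walk ?\<sigma> u)) = (\<Sum>u\<in>U. wcost w (bag_walk \<sigma> u)) + 2 * key v"
      unfolding sumU[of "wcost w"] merge_step_sum[of "wcost w"] merge_step_bag(2) by simp
    moreover have "(\<Sum>t\<in>{..<n} - ?U. units_dist (tour_units ?\<sigma> t))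
        = (\<Sum>t\<in>{..<n} - U. units_dist (tour_units \<sigma> t))"
      unfolding P(1) using P(2) vY by (simp add: keep_bag_def merge_bags_def units_dist_def)
    moreover have "(\<Sum>t\<in>{..<n} - ?U. if 2 * d t \<le> k then 2 * key t else 0)
        = 2 * key v + (\<Sum>t\<in>{..<n} - U. if 2 * d t \<le> k then 2 * key t else 0)"
      unfolding P(1) using P(2) small by simp
    moreover have "cost_ok U \<sigma>" using inv by (simp add: bag_inv_def)
    ultimately show ?thesis unfolding cost_ok_def by simp
  qed
  moreover have "units_ok n d ?U ?\<sigma>"
  proof -
    obtain own where own: "\<And>j. j < n \<Longrightarrow> own j < n"
      "\<And>i j. i < n \<Longrightarrow> j < n \<Longrightarrow> current_units U \<sigma> i j = (if i = own j then d j else 0)"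
      using inv unfolding bag_inv_def units_ok_def by blast
    have "r < n" "v < n" using U by auto
    \<comment> \<open>What slot \<open>v\<close> carried now lies in the bag of \<open>r\<close>, so
      owner \<open>v\<close> is replaced by \<open>r\<close>. Slot \<open>v\<close> switches to its
      tour units, which are still 0.\<close>
    then have "current_units ?U ?\<sigma> i j = (if i = (if own j = v then r else own j) then d j else 0)"
      if "i < n" "j < n" for i j
    proof -
      have Z: "current_units U \<sigma> v j = bag_units \<sigma> v j" "current_units U \<sigma> r j = bag_units \<sigma> r j"
        using U by (simp_all add: current_units_def)
      consider "i = v" | "i = r" | "i \<noteq> v" "i \<noteq> r" by blast
      then show ?thesis
      proof cases
        case 1
        then show ?thesis
          using vY that Z own(2)[of v j] own(2)[of r j] \<open>r < n\<close> \<open>v < n\<close> U(4)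
          by (simp add: current_units_def keep_bag_def merge_bags_def)
      next
        case 2
        then show ?thesis
          using vY that Z own(2)[of v j] own(2)[of r j] \<open>r < n\<close> \<open>v < n\<close> U(3,4)
          by (simp add: current_units_def keep_bag_def merge_bags_def)
      next
        case 3
        then have "current_units ?U ?\<sigma> i j = current_units U \<sigma> i j"
          by (simp add: current_units_def keep_bag_def merge_bags_def)
        then show ?thesis using own(2)[OF that] 3 by auto
      qed
    qed
    then show ?thesis
      unfolding units_ok_def using own(1) \<open>r < n\<close>
      by (intro exI[of _ "\<lambda>j. if own j = v then r else own j"]) auto
  qed
  moreover have "(\<Sum>u\<in>?U. length (bag_walk ?\<sigma> u)) + card ?U \<le> 2 * n"
    using inv card.remove[OF fin U(2)]
    unfolding sumU[of length] bag_inv_def merge_step_sum[of length] by (simp add: merge_bags_def)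
  moreover have "\<forall>u\<in>?U. bag_ok n ?\<sigma> u \<and> load_ok k d ?\<sigma> u \<and> (\<forall>j<n. tour_units ?\<sigma> u j = 0)"
  proof
    fix u assume "u \<in> ?U"
    then show "bag_ok n ?\<sigma> u \<and> load_ok k d ?\<sigma> u \<and> (\<forall>j<n. tour_units ?\<sigma> u j = 0)"
      using inv merge_step_bag(1) load small
      by (cases "u = r") (auto simp: bag_inv_def bag_ok_def load_ok_def keep_bag_def merge_bags_def)
  qed
  moreover have "\<forall>t\<in>{..<n} - ?U. tour_ok n m k (tour_walk ?\<sigma> t) (tour_units ?\<sigma> t)"
    unfolding P(1) using inv U(2) vY m_pos
    by (auto simp: bag_inv_def keep_bag_def merge_bags_def tour_ok_def)
  ultimately show ?thesis unfolding bag_inv_def by blast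
qed

text \<open>Two payments are combined: \<open>key v\<close> pays for joining the walks, and the load
  above \<open>k/2\<close> pays for the detour to the depot. The parent \<open>r\<close> remains
  active with load 0.\<close>

lemma inv_emit_step:
  assumes load: "k < 2 * bag_load (merge_bags r v \<sigma>) r"
    and x: "best x (bag_walk (merge_bags r v \<sigma>) r)"
  shows "bag_inv (U - {v}) (emit_bag nd x r v (merge_bags r v \<sigma>))"
proof -
  let ?U = "U - {v}" and ?\<sigma> = "emit_bag nd x r v (merge_bags r v \<sigma>)"
  let ?l = "bag_walk (merge_bags r v \<sigma>) r" and ?y = "bag_units (merge_bags r v \<sigma>) r"
  have fin: "finite U" using U finite_subset by blast
  note P = tours_insert
  have rn: "r < n" "v < n" using U by auto
  have vY: "\<And>j. j < n \<Longrightarrow> tour_units \<sigma> v j = 0" "\<And>j. j < n \<Longrightarrow> tour_units \<sigma> r j = 0"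
    using inv U by (auto simp: bag_inv_def)
  have bag: "closed_walk n r ?l" "\<And>j. j < n \<Longrightarrow> ?y j \<noteq> 0 \<Longrightarrow> j \<in> set ?l"
    "bag_load (merge_bags r v \<sigma>) r = (\<Sum>j<n. ?y j)"
    using merge_step_bag(1) by (auto simp: bag_ok_def)
  have xl: "x < length ?l" using x by (simp add: best_def)
  have L: "(\<Sum>j<n. ?y j) \<le> k" using bag(3) merge_step_bag(3) by simp
  note tour = depot_tour[OF bag(1) xl bag(2) L]
  have price: "2 * dd (?l ! x) \<le> alpha * units_dist ?y"
    using detour_le_units_dist[OF x _ bag(2)] load bag(1,3) by (simp add: closed_walk_def)
  have sumU: "(\<Sum>u\<in>?U. g (bag_walk ?\<sigma> u)) = g [r] + (\<Sum>u\<in>U - {v} - {r}. g (bag_walk \<sigma> u))"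
    for g :: "nat list \<Rightarrow> 'b :: comm_monoid_add"
    using sum.remove[of ?U r "\<lambda>u. g (bag_walk ?\<sigma> u)"] fin U
    by (simp add: emit_bag_def merge_bags_def)
  have "cost_ok ?U ?\<sigma>"
  proof -
    have "(\<Sum>t\<in>{..<n} - ?U. wcost w (tour_walk ?\<sigma> t))
        = wcost w (bag_walk \<sigma> r) + wcost w (bag_walk \<sigma> v) + 2 * key v + 2 * dd (?l ! x)
          + (\<Sum>t\<in>{..<n} - U. wcost w (tour_walk \<sigma> t))"
      unfolding P(1) merge_step_bag(2)[symmetric] using P(2) tour(2) U(2)
      by (auto simp: emit_bag_def merge_bags_def intro!: sum.cong)
    moreover have "(\<Sum>u\<in>?U. wcost w (bag_walk ?\<sigma> u)) + wcost w (bag_walk \<sigma> r) + wcost w (bag_walk \<sigma> v)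
        = (\<Sum>u\<in>U. wcost w (bag_walk \<sigma> u))"
      unfolding sumU[of "wcost w"] merge_step_sum[of "wcost w"] by simp
    moreover have "(\<Sum>t\<in>{..<n} - ?U. units_dist (tour_units ?\<sigma> t))
        = units_dist ?y + (\<Sum>t\<in>{..<n} - U. units_dist (tour_units \<sigma> t))"
      unfolding P(1) using P(2) U(2) by (auto simp: emit_bag_def merge_bags_def intro!: sum.cong)
    moreover have "(\<Sum>t\<in>{..<n} - ?U. if 2 * d t \<le> k then 2 * key t else 0)
        = 2 * key v + (\<Sum>t\<in>{..<n} - U. if 2 * d t \<le> k then 2 * key t else 0)"
      unfolding P(1) using P(2) small by simp
    moreover have "cost_ok U \<sigma>" using inv by (simp add: bag_inv_def)
    ultimately show ?thesis using price unfolding cost_ok_def by (simp add: distrib_left)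
  qed
  moreover have "units_ok n d ?U ?\<sigma>"
  proof -
    obtain own where own: "\<And>j. j < n \<Longrightarrow> own j < n"
      "\<And>i j. i < n \<Longrightarrow> j < n \<Longrightarrow> current_units U \<sigma> i j = (if i = own j then d j else 0)"
      using inv unfolding bag_inv_def units_ok_def by blast
    \<comment> \<open>Here ownership moves in the opposite direction: the bag of \<open>r\<close> is
      emptied into the tour slot of \<open>v\<close>, which keeps its former units as part of the
      merged bag.\<close>
    have "current_units ?U ?\<sigma> i j = (if i = (if own j = r then v else own j) then d j else 0)"
      if "i < n" "j < n" for i j
    proof -
      have Z: "current_units U \<sigma> v j = bag_units \<sigma> v j" "current_units U \<sigma> r j = bag_units \<sigma> r j"
        using U by (simp_all add: current_units_def)
      consider "i = v" | "i = r" | "i \<noteq> v" "i \<noteq> r" by blast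
      then show ?thesis
      proof cases
        case 1
        then show ?thesis
          using vY that Z own(2)[of v j] own(2)[of r j] \<open>r < n\<close> \<open>v < n\<close> U(4)
          by (simp add: current_units_def emit_bag_def merge_bags_def)
      next
        case 2
        then show ?thesis
          using vY that Z own(2)[of v j] own(2)[of r j] \<open>r < n\<close> \<open>v < n\<close> U(3,4)
          by (simp add: current_units_def emit_bag_def merge_bags_def)
      next
        case 3
        then have "current_units ?U ?\<sigma> i j = current_units U \<sigma> i j"
          by (simp add: current_units_def emit_bag_def merge_bags_def)
        then show ?thesis using own(2)[OF that] 3 by auto
      qed
    qed
    then show ?thesis
      unfolding units_ok_def using own(1) rn
      by (intro exI[of _ "\<lambda>j. if own j = r then v else own j"]) auto
  qed
  moreover have "(\<Sum>u\<in>?U. length (bag_walk ?\<sigma> u)) + card ?U \<le> 2 * n"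
    using inv card.remove[OF fin U(2)]
    unfolding sumU[of length] bag_inv_def merge_step_sum[of length] by simp
  moreover have "\<forall>u\<in>?U. bag_ok n ?\<sigma> u \<and> load_ok k d ?\<sigma> u \<and> (\<forall>j<n. tour_units ?\<sigma> u j = 0)"
  proof
    fix u assume "u \<in> ?U"
    then show "bag_ok n ?\<sigma> u \<and> load_ok k d ?\<sigma> u \<and> (\<forall>j<n. tour_units ?\<sigma> u j = 0)"
      using inv small rn
      by (cases "u = r")
        (auto simp: bag_inv_def bag_ok_def load_ok_def emit_bag_def merge_bags_def closed_walk_def)
  qed
  moreover have "\<forall>t\<in>{..<n} - ?U. tour_ok n m k (tour_walk ?\<sigma> t) (tour_units ?\<sigma> t)"
    unfolding P(1) using inv U(2) tour(1) by (auto simp: bag_inv_def emit_bag_def merge_bags_def)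
  ultimately show ?thesis unfolding bag_inv_def by blast
qed

end

end

section \<open>The program\<close>

text \<open>
  Memory layout, besides input and output: natural number arrays 7 (1 + parent, 0 for the depot),
  8 (visited), 9 (Prim order), 10 (nearest depot), 11 (load), 12 (walk length), 13 (walk) and
  14 (units) of the bags; real arrays 1 (distance to the depot) and 2 (key). Scalars: 0 and 1 are
  loop counters, 2 is the selected vertex, 3 the processed vertex, 4 the bag it is merged into,
  5 the position on the walk that is nearest to a depot.
\<close>

notation Seq (infixr \<open>;;\<close> 60)

abbreviation Arr :: "nat \<Rightarrow> nexp \<Rightarrow> nexp" where "Arr a i \<equiv> NCell a i (NConst 0)"
abbreviation RArr :: "nat \<Rightarrow> nexp \<Rightarrow> rexp" where "RArr a i \<equiv> RCell a i (NConst 0)"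
abbreviation num_customers :: nexp where "num_customers \<equiv> NCell 0 (NConst 0) (NConst 0)"
abbreviation num_depots :: nexp where "num_depots \<equiv> NCell 0 (NConst 0) (NConst 1)"
abbreviation cap :: nexp where "cap \<equiv> NCell 0 (NConst 0) (NConst 2)"
text \<open>The machine cannot divide; comparing the doubled demand with \<open>k\<close> is
  equivalent to comparing the demand with \<open>k div 2\<close>.\<close>

abbreviation Small :: "nexp \<Rightarrow> bexp" where
  "Small i \<equiv> BNot (NLess cap (NAdd (Arr 1 i) (Arr 1 i)))"

definition nearest_com :: com where
  "nearest_com = For 1 num_depots
     (Cond (RLess (RCell 0 (NAdd num_customers (Var 1)) (Var 0)) (RArr 1 (Var 0)))
       (RAssign 1 (Var 0) (NConst 0) (RCell 0 (NAdd num_customers (Var 1)) (Var 0)) ;;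
        NAssign 10 (Var 0) (NConst 0) (NAdd num_customers (Var 1)))
       Skip)"

definition fresh_bag_com :: com where
  "fresh_bag_com =
      RAssign 2 (Var 0) (NConst 0) (RArr 1 (Var 0)) ;;
      NAssign 11 (Var 0) (NConst 0) (Arr 1 (Var 0)) ;;
      NAssign 12 (Var 0) (NConst 0) (NConst 1) ;;
      NAssign 13 (Var 0) (NConst 0) (Var 0) ;;
      NAssign 14 (Var 0) (Var 0) (Arr 1 (Var 0))"

definition init_com :: com where
  "init_com = For 0 num_customers
     (NAssign 10 (Var 0) (NConst 0) num_customers ;;
      RAssign 1 (Var 0) (NConst 0) (RCell 0 num_customers (Var 0)) ;;
      nearest_com ;;
      fresh_bag_com)"

text \<open>The value \<open>num_customers\<close> in scalar 2 means that there is no candidate yet.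
  The nested negations express a disjunction: no candidate, or a smaller key than the
  candidate.\<close>

definition select_com :: com where
  "select_com = SetVar 2 num_customers ;;
     For 1 num_customers
      (Cond (BAnd (NLess (Arr 8 (Var 1)) (NConst 1))
              (BNot (BAnd (NLess (Var 2) num_customers)
                 (BNot (RLess (RArr 2 (Var 1)) (RArr 2 (Var 2)))))))
        (SetVar 2 (Var 1)) Skip)"

text \<open>Large customers are never relaxed and never relax others, so they remain children of the
  depot without children of their own.\<close>

definition relax_com :: com where
  "relax_com = For 1 num_customers
     (Cond (BAnd (NLess (Arr 8 (Var 1)) (NConst 1))
             (BAnd (BAnd (Small (Var 2)) (Small (Var 1)))
               (RLess (RCell 0 (Var 2) (Var 1)) (RArr 2 (Var 1)))))
       (RAssign 2 (Var 1) (NConst 0) (RCell 0 (Var 2) (Var 1)) ;;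
        NAssign 7 (Var 1) (NConst 0) (NAdd (Var 2) (NConst 1)))
       Skip)"

definition prim_com :: com where
  "prim_com = For 0 num_customers
     (select_com ;;
      NAssign 8 (Var 2) (NConst 0) (NConst 1) ;;
      NAssign 9 (Var 0) (NConst 0) (Var 2) ;;
      relax_com)"

definition append_com :: com where
  "append_com = For 1 (Arr 12 (Var 3))
     (NAssign 13 (Var 4) (NAdd (Arr 12 (Var 4)) (Var 1)) (NCell 13 (Var 3) (Var 1)))"

definition add_units_com :: com where
  "add_units_com = For 1 num_customers
     (NAssign 14 (Var 4) (Var 1) (NAdd (NCell 14 (Var 4) (Var 1)) (NCell 14 (Var 3) (Var 1))))"

text \<open>The length of the parent's walk is raised only after copying, because the target
  positions are computed from its old value.\<close>

definition merge_com :: com where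
  "merge_com =
     SetVar 4 (NSub (Arr 7 (Var 3)) (NConst 1)) ;;
     append_com ;;
     NAssign 13 (Var 4) (NAdd (Arr 12 (Var 4)) (Arr 12 (Var 3))) (Var 4) ;;
     NAssign 12 (Var 4) (NConst 0) (NAdd (NAdd (Arr 12 (Var 4)) (Arr 12 (Var 3))) (NConst 1)) ;;
     add_units_com ;;
     NAssign 11 (Var 4) (NConst 0) (NAdd (Arr 11 (Var 4)) (Arr 11 (Var 3)))"

definition best_com :: com where
  "best_com = SetVar 5 (NConst 0) ;;
     For 1 (Arr 12 (Var 4))
      (Cond (RLess (RArr 1 (NCell 13 (Var 4) (Var 1))) (RArr 1 (NCell 13 (Var 4) (Var 5))))
        (SetVar 5 (Var 1)) Skip)"

definition write_walk_com :: com where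
  "write_walk_com = For 1 (Arr 12 (Var 4))
     (Cond (NLess (NAdd (Var 5) (Var 1)) (Arr 12 (Var 4)))
       (NAssign 4 (Var 3) (NAdd (Var 1) (NConst 1)) (NCell 13 (Var 4) (NAdd (Var 5) (Var 1))))
       (NAssign 4 (Var 3) (NAdd (Var 1) (NConst 1))
          (NCell 13 (Var 4) (NSub (NAdd (NAdd (Var 5) (Var 1)) (NConst 1)) (Arr 12 (Var 4))))))"

definition write_units_com :: com where
  "write_units_com = For 1 num_customers
     (NAssign 5 (Var 3) (Var 1) (NCell 14 (Var 4) (Var 1)) ;;
      NAssign 14 (Var 4) (Var 1) (NConst 0))"

text \<open>The walk array 13 is left alone. Since the walk of bag \<open>r\<close> starts with
  \<open>r\<close>, setting its length to 1 already turns it into \<open>[r]\<close>.\<close>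

definition emit_com :: com where
  "emit_com =
     best_com ;;
     NAssign 4 (Var 3) (NConst 0) (Arr 10 (NCell 13 (Var 4) (Var 5))) ;;
     write_walk_com ;;
     NAssign 4 (Var 3) (NAdd (Arr 12 (Var 4)) (NConst 1)) (NCell 4 (Var 3) (NConst 0)) ;;
     NAssign 3 (Var 3) (NConst 0) (NAdd (Arr 12 (Var 4)) (NConst 2)) ;;
     write_units_com ;;
     NAssign 11 (Var 4) (NConst 0) (NConst 0) ;;
     NAssign 12 (Var 4) (NConst 0) (NConst 1)"

definition keep_com :: com where
  "keep_com = NAssign 3 (Var 3) (NConst 0) (NConst 1) ;;
     NAssign 4 (Var 3) (NConst 0) num_customers"

definition bag_com :: com where
  "bag_com = For 0 num_customers
     (SetVar 3 (Arr 9 (NSub (NSub num_customers (Var 0)) (NConst 1))) ;;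
      Cond (NLess (NConst 0) (Arr 7 (Var 3))) merge_com (SetVar 4 (Var 3)) ;;
      Cond (BAnd (NLess (NConst 0) (Arr 7 (Var 3)))
             (BNot (NLess cap (NAdd (Arr 11 (Var 4)) (Arr 11 (Var 4))))))
        keep_com emit_com)"

definition vrp_com :: com where
  "vrp_com = init_com ;; prim_com ;; bag_com ;; NAssign 2 (NConst 0) (NConst 0) num_customers"

section \<open>Memory contents that represent the abstract data\<close>

definition input_ok :: "nat \<Rightarrow> nat \<Rightarrow> nat \<Rightarrow> (nat \<Rightarrow> nat) \<Rightarrow> (nat \<Rightarrow> nat \<Rightarrow> real) \<Rightarrow> state \<Rightarrow> bool" where
  "input_ok n m k d w s \<longleftrightarrow>
     nmem s (0, 0, 0) = n \<and> nmem s (0, 0, 1) = m \<and> nmem s (0, 0, 2) = k \<and>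
     (\<forall>i<n. nmem s (1, i, 0) = d i) \<and>
     (\<forall>i<n + m. \<forall>j<n + m. rmem s (0, i, j) = w i j)"

definition nearest_ok :: "nat \<Rightarrow> nat \<Rightarrow> (nat \<Rightarrow> nat \<Rightarrow> real) \<Rightarrow> state \<Rightarrow> nat \<Rightarrow> bool" where
  "nearest_ok n m w s i \<longleftrightarrow>
     n \<le> nmem s (10, i, 0) \<and> nmem s (10, i, 0) < n + m \<and>
     rmem s (1, i, 0) = w (nmem s (10, i, 0)) i \<and> (\<forall>u<m. rmem s (1, i, 0) \<le> w (n + u) i)"

definition represents :: "nat \<Rightarrow> bags \<Rightarrow> state \<Rightarrow> nat \<Rightarrow> bool" where
  "represents n \<sigma> s i \<longleftrightarrow>
     nmem s (12, i, 0) = length (bag_walk \<sigma> i) \<and>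
     (\<forall>q<length (bag_walk \<sigma> i). nmem s (13, i, q) = bag_walk \<sigma> i ! q) \<and>
     (\<forall>j<n. nmem s (14, i, j) = bag_units \<sigma> i j) \<and>
     nmem s (11, i, 0) = bag_load \<sigma> i \<and>
     nmem s (3, i, 0) = length (tour_walk \<sigma> i) \<and>
     (\<forall>q<length (tour_walk \<sigma> i). nmem s (4, i, q) = tour_walk \<sigma> i ! q) \<and>
     (\<forall>j<n. nmem s (5, i, j) = tour_units \<sigma> i j)"

text \<open>The zero cells on which later phases rely: parent 0 is the depot, mark 0 is unvisited,
  and tour slots of length 0 without units agree with \<open>initial_bags\<close>. Array 14 is
  treated apart, as the initialisation fills it row by row.\<close>

definition blank :: "state \<Rightarrow> bool" where
  "blank s \<longleftrightarrow> (\<forall>i. nmem s (7, i, 0) = 0 \<and> nmem s (8, i, 0) = 0 \<and> nmem s (3, i, 0) = 0) \<and>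
     (\<forall>i j. nmem s (5, i, j) = 0)"

lemma set_scalar_preserves [simp]:
  "input_ok n m k d w (set_nat 6 a b c s) \<longleftrightarrow> input_ok n m k d w s"
  "nearest_ok n m w (set_nat 6 a b c s) i \<longleftrightarrow> nearest_ok n m w s i"
  "represents n \<sigma> (set_nat 6 a b c s) i \<longleftrightarrow> represents n \<sigma> s i"
  "blank (set_nat 6 a b c s) \<longleftrightarrow> blank s"
  by (simp_all add: input_ok_def nearest_ok_def represents_def blank_def)

lemma runs_nearest:
  assumes "input_ok n m k d w s" "nmem s (6, 0, 0) = i" "i < n" "0 < m"
    and "nmem s (10, i, 0) = n" "rmem s (1, i, 0) = w n i"
  shows "runs nearest_com s (2 + m * 5) (\<lambda>s'. nearest_ok n m w s' i \<and>
    (\<forall>a b c. a \<notin> {6, 10} \<or> (a = 6 \<and> b \<noteq> 1) \<or> (a = 10 \<and> b \<noteq> i) \<longrightarrow> nmem s' (a, b, c) = nmem s (a, b, c)) \<and>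
    (\<forall>a b c. a \<noteq> 1 \<or> b \<noteq> i \<longrightarrow> rmem s' (a, b, c) = rmem s (a, b, c)))"
proof -
  let ?Q = "\<lambda>u (s' :: state). n \<le> nmem s' (10, i, 0) \<and> nmem s' (10, i, 0) < n + m \<and>
     rmem s' (1, i, 0) = w (nmem s' (10, i, 0)) i \<and> (\<forall>u'<u. rmem s' (1, i, 0) \<le> w (n + u') i) \<and>
    (\<forall>a b c. a \<notin> {6, 10} \<or> (a = 6 \<and> b \<noteq> 1) \<or> (a = 10 \<and> b \<noteq> i) \<longrightarrow> nmem s' (a, b, c) = nmem s (a, b, c)) \<and>
    (\<forall>a b c. a \<noteq> 1 \<or> b \<noteq> i \<longrightarrow> rmem s' (a, b, c) = rmem s (a, b, c))"
  have "runs nearest_com s (2 + m * (3 + 2)) (?Q m)"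
    unfolding nearest_com_def
  proof (rule runs_For[where Q = ?Q])
    show "?Q 0 (set_nat 6 1 0 0 s)" using assms by simp
  next
    fix u t assume u: "u < m" and Q: "?Q u t" and t: "nmem t (6, 1, 0) = u"
    have e: "nmem t (0, 0, 0) = n" "nmem t (6, 0, 0) = i" "rmem t (0, n + u, i) = w (n + u) i"
      using Q assms u by (auto simp: input_ok_def)
    show "runs (Cond (RLess (RCell 0 (NAdd num_customers (Var 1)) (Var 0)) (RArr 1 (Var 0)))
       (RAssign 1 (Var 0) (NConst 0) (RCell 0 (NAdd num_customers (Var 1)) (Var 0)) ;;
        NAssign 10 (Var 0) (NConst 0) (NAdd num_customers (Var 1)))
       Skip) t 3 (\<lambda>s'. nmem s' (6, 1, 0) = u \<and> ?Q (Suc u) (set_nat 6 1 0 (Suc u) s'))"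
      unfolding numeral_3_eq_3
    proof (rule runs_Cond)
      show "runs (RAssign 1 (Var 0) (NConst 0) (RCell 0 (NAdd num_customers (Var 1)) (Var 0)) ;;
        NAssign 10 (Var 0) (NConst 0) (NAdd num_customers (Var 1))) t (Suc (Suc 0)) 
        (\<lambda>s'. nmem s' (6, 1, 0) = u \<and> ?Q (Suc u) (set_nat 6 1 0 (Suc u) s'))"
        if "bval (RLess (RCell 0 (NAdd num_customers (Var 1)) (Var 0)) (RArr 1 (Var 0))) t"
        by (rule runs_Seq_RAssign, rule runs_NAssign)
          (use that e Q t u in \<open>auto simp: less_Suc_eq intro: less_imp_le order.trans\<close>)
      show "runs Skip t (Suc (Suc 0)) (\<lambda>s'. nmem s' (6, 1, 0) = u \<and> ?Q (Suc u) (set_nat 6 1 0 (Suc u) s'))"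
        if "\<not> bval (RLess (RCell 0 (NAdd num_customers (Var 1)) (Var 0)) (RArr 1 (Var 0))) t"
        by (rule runs_Skip) (use that e Q t u in \<open>auto simp: less_Suc_eq\<close>)
    qed
  next
    fix u t assume "?Q u t"
    then show "nval num_depots t = m" using assms by (simp add: input_ok_def)
  qed
  then show ?thesis by (rule runs_mono) (auto simp: nearest_ok_def)
qed

lemma runs_init:
  assumes "input_ok n m k d w s" "0 < m" "blank s" "\<And>i j. nmem s (14, i, j) = 0"
  shows "runs init_com s (2 + n * (11 + m * 5)) (\<lambda>s'. input_ok n m k d w s' \<and> blank s' \<and>
    (\<forall>i<n. nearest_ok n m w s' i \<and> rmem s' (2, i, 0) = rmem s' (1, i, 0) \<and>
      represents n (initial_bags d) s' i))"
proof -
  let ?Q = "\<lambda>i (s' :: state). input_ok n m k d w s' \<and> blank s' \<and> (\<forall>j\<ge>i. \<forall>q. nmem s' (14, j, q) = 0) \<and>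
    (\<forall>i'<i. nearest_ok n m w s' i' \<and> rmem s' (2, i', 0) = rmem s' (1, i', 0) \<and>
      represents n (initial_bags d) s' i')"
  have "runs init_com s (2 + n * ((2 + (2 + m * 5) + 5) + 2)) (?Q n)"
    unfolding init_com_def
  proof (rule runs_For[where Q = ?Q])
    show "?Q 0 (set_nat 6 0 0 0 s)" using assms by (simp add: input_ok_def blank_def)
  next
    fix i t assume i: "i < n" and Q: "?Q i t" and t: "nmem t (6, 0, 0) = i"
    define t2 where "t2 = set_real 1 i 0 (w n i) (set_nat 10 i 0 n t)"
    let ?P = "\<lambda>s' :: state. nearest_ok n m w s' i \<and>
    (\<forall>a b c. a \<notin> {6, 10} \<or> (a = 6 \<and> b \<noteq> 1) \<or> (a = 10 \<and> b \<noteq> i) \<longrightarrow> nmem s' (a, b, c) = nmem t2 (a, b, c)) \<and>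
    (\<forall>a b c. a \<noteq> 1 \<or> b \<noteq> i \<longrightarrow> rmem s' (a, b, c) = rmem t2 (a, b, c))"
    have e: "nmem t (0, 0, 0) = n" "rmem t (0, n, i) = w n i"
      using Q i assms(2) by (auto simp: input_ok_def)
    have near: "runs nearest_com t2 (2 + m * 5) ?P"
      by (rule runs_nearest[of n m k d w]) (use Q t i assms(2) in \<open>auto simp: t2_def input_ok_def\<close>)
    have rest: "runs fresh_bag_com t3 5
        (\<lambda>s'. nmem s' (6, 0, 0) = i \<and> ?Q (Suc i) (set_nat 6 0 0 (Suc i) s'))" if P: "?P t3" for t3
    proof -
      have e3: "nmem t3 (6, 0, 0) = i" "nmem t3 (1, i, 0) = d i"
        using P Q t i by (auto simp: t2_def input_ok_def)
      let ?t = "set_nat 14 i i (d i) (set_nat 13 i 0 i (set_nat 12 i 0 1 (set_nat 11 i 0 (d i)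
        (set_real 2 i 0 (rmem t3 (1, i, 0)) t3))))"
      have io: "input_ok n m k d w ?t" using P Q by (auto simp: t2_def input_ok_def)
      have bl: "blank ?t" using P Q by (auto simp: t2_def blank_def)
      have "nearest_ok n m w ?t i' \<and> rmem ?t (2, i', 0) = rmem ?t (1, i', 0) \<and>
        represents n (initial_bags d) ?t i'" if "i' < Suc i" for i'
        using that P Q
        by (cases "i' = i") (auto simp: less_Suc_eq t2_def nearest_ok_def represents_def blank_def initial_bags_def)
      moreover have "\<forall>j\<ge>Suc i. \<forall>q. nmem ?t (14, j, q) = 0"
        using P Q by (auto simp: t2_def)
      ultimately have "?Q (Suc i) (set_nat 6 0 0 (Suc i) ?t)"
        using io bl by simp
      then have "runs fresh_bag_com t3 (Suc (Suc (Suc (Suc 1))))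
        (\<lambda>s'. nmem s' (6, 0, 0) = i \<and> ?Q (Suc i) (set_nat 6 0 0 (Suc i) s'))"
        unfolding fresh_bag_com_def
        by (intro runs_Seq_RAssign runs_Seq_NAssign runs_NAssign) (simp_all add: e3[simplified])
      then show ?thesis by (rule runs_mono) auto
    qed
    show "runs (NAssign 10 (Var 0) (NConst 0) num_customers ;;
      RAssign 1 (Var 0) (NConst 0) (RCell 0 num_customers (Var 0)) ;;
      nearest_com ;;
      fresh_bag_com) t (2 + (2 + m * 5) + 5)
        (\<lambda>s'. nmem s' (6, 0, 0) = i \<and> ?Q (Suc i) (set_nat 6 0 0 (Suc i) s'))"
    proof -
      have "runs (nearest_com ;;
      fresh_bag_com) t2 ((2 + m * 5) + 5)
        (\<lambda>s'. nmem s' (6, 0, 0) = i \<and> ?Q (Suc i) (set_nat 6 0 0 (Suc i) s'))"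
        by (rule runs_Seq, rule runs_mono[OF near]) (use rest in auto)
      then have "runs (NAssign 10 (Var 0) (NConst 0) num_customers ;;
      RAssign 1 (Var 0) (NConst 0) (RCell 0 num_customers (Var 0)) ;;
      nearest_com ;;
      fresh_bag_com) t (Suc (Suc ((2 + m * 5) + 5)))
        (\<lambda>s'. nmem s' (6, 0, 0) = i \<and> ?Q (Suc i) (set_nat 6 0 0 (Suc i) s'))"
        by (intro runs_Seq_RAssign runs_Seq_NAssign) (simp add: t e t2_def)
      then show ?thesis by (rule runs_mono) auto
    qed
  next
    fix i t assume "?Q i t"
    then show "nval num_customers t = n" by (simp add: input_ok_def)
  qed
  then show ?thesis by (rule runs_mono) auto
qed

text \<open>The clause on \<open>t\<close> says that a visited customer has a parent visited before
  it; it is vacuous for unvisited ones. The last two clauses are the greedy property: an unvisited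
  key is below all admissible edges to the depot and the visited set, and the key of the
  \<open>s\<close>-th selected customer is below all such edges of every customer that was unvisited
  at that moment. Admissible edges between customers have two small ends.\<close>

definition prim_inv :: "nat \<Rightarrow> nat \<Rightarrow> (nat \<Rightarrow> nat) \<Rightarrow> (nat \<Rightarrow> nat \<Rightarrow> real) \<Rightarrow> (nat \<Rightarrow> real) \<Rightarrow> nat \<Rightarrow>
    (nat \<Rightarrow> nat) \<Rightarrow> (nat \<Rightarrow> nat) \<Rightarrow> (nat \<Rightarrow> real) \<Rightarrow> bool" where
  "prim_inv n k d w dd i ord par key \<longleftrightarrow>
     inj_on ord {..<i} \<and> ord ` {..<i} \<subseteq> {..<n} \<and>
     (\<forall>x<n. par x = 0 \<and> key x = dd x \<or>
       (\<exists>r<i. par x = Suc (ord r) \<and> key x = w (ord r) x \<and> 2 * d (ord r) \<le> k \<and> 2 * d x \<le> k \<and>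
         (\<forall>t<i. x = ord t \<longrightarrow> r < t))) \<and>
     (\<forall>y<n. y \<notin> ord ` {..<i} \<longrightarrow> key y \<le> dd y \<and>
       (\<forall>r<i. 2 * d (ord r) \<le> k \<longrightarrow> 2 * d y \<le> k \<longrightarrow> key y \<le> w (ord r) y)) \<and>
     (\<forall>s<i. \<forall>y<n. y \<notin> ord ` {..<s} \<longrightarrow> key (ord s) \<le> dd y \<and>
       (\<forall>r<s. 2 * d (ord r) \<le> k \<longrightarrow> 2 * d y \<le> k \<longrightarrow> key (ord s) \<le> w (ord r) y))"

lemma prim_inv_step:
  assumes inv: "prim_inv n k d w dd i ord par key"
    and b: "b < n" "b \<notin> ord ` {..<i}" "\<And>y. y < n \<Longrightarrow> y \<notin> ord ` {..<i} \<Longrightarrow> key b \<le> key y"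
    and ord': "\<And>t. t < i \<Longrightarrow> ord' t = ord t" "ord' i = b"
    and upd: "\<And>x. x < n \<Longrightarrow>
      (if x \<notin> ord ` {..<i} \<and> x \<noteq> b \<and> 2 * d b \<le> k \<and> 2 * d x \<le> k \<and> w b x < key x
       then key' x = w b x \<and> par' x = Suc b else key' x = key x \<and> par' x = par x)"
  shows "prim_inv n k d w dd (Suc i) ord' par' key'"
proof -
  note inv' = inv[unfolded prim_inv_def]
  note par = inv'[THEN conjunct2, THEN conjunct2, THEN conjunct1, rule_format]
  note key_y = inv'[THEN conjunct2, THEN conjunct2, THEN conjunct2, THEN conjunct1, rule_format]
  note key_s = inv'[THEN conjunct2, THEN conjunct2, THEN conjunct2, THEN conjunct2, rule_format]
  have img: "ord' ` {..<s} = ord ` {..<s}" if "s \<le> i" for s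
    using ord'(1) that by (intro image_cong) auto
  have img': "ord' ` {..<Suc i} = insert b (ord ` {..<i})"
    using img[of i] ord'(2) by (simp add: lessThan_Suc)
  have 1: "inj_on ord' {..<Suc i}"
  proof -
    have "inj_on ord' {..<i}"
      using inv ord'(1) by (simp add: prim_inv_def inj_on_def)
    then show ?thesis using b(2) img[of i] ord'(2) by (simp add: lessThan_Suc inj_on_insert)
  qed
  have 2: "ord' ` {..<Suc i} \<subseteq> {..<n}"
    unfolding img' using inv b(1) by (auto simp: prim_inv_def)
  have 3: "par' x = 0 \<and> key' x = dd x \<or>
       (\<exists>r<Suc i. par' x = Suc (ord' r) \<and> key' x = w (ord' r) x \<and> 2 * d (ord' r) \<le> k \<and> 2 * d x \<le> k \<and>
         (\<forall>t<Suc i. x = ord' t \<longrightarrow> r < t))" if x: "x < n" for x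
  proof (cases "x \<notin> ord ` {..<i} \<and> x \<noteq> b \<and> 2 * d b \<le> k \<and> 2 * d x \<le> k \<and> w b x < key x")
    case True
    \<comment> \<open>A relaxed customer is still unvisited, so its new parent has no visiting time
      to be compared with.\<close>
    then have "\<forall>t<Suc i. x \<noteq> ord' t" using img' by (metis imageI insertE lessThan_iff)
    then show ?thesis using upd[OF x] True ord'(2) by (intro disjI2 exI[of _ i]) auto
  next
    case False
    then have e: "key' x = key x" "par' x = par x" using upd[OF x] by auto
    consider "par x = 0" "key x = dd x" | r where "r < i" "par x = Suc (ord r)" "key x = w (ord r) x"
      "2 * d (ord r) \<le> k" "2 * d x \<le> k" "\<forall>t<i. x = ord t \<longrightarrow> r < t"
      using par[OF x] by (elim disjE exE conjE) simp_all
    then show ?thesis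
    proof cases
      case 2
      then show ?thesis using e ord' by (intro disjI2 exI[of _ r]) (auto simp: less_Suc_eq)
    qed (simp add: e)
  qed
  have key'_le: "key' y \<le> key y" if "y < n" for y
    using upd[OF that] by (auto split: if_splits)
  have 4: "key' y \<le> dd y \<and>
       (\<forall>r<Suc i. 2 * d (ord' r) \<le> k \<longrightarrow> 2 * d y \<le> k \<longrightarrow> key' y \<le> w (ord' r) y)"
    if y: "y < n" "y \<notin> ord' ` {..<Suc i}" for y
  proof -
    have y': "y \<notin> ord ` {..<i}" "y \<noteq> b" using y(2) unfolding img' by auto
    have "key y \<le> dd y" "\<forall>r<i. 2 * d (ord r) \<le> k \<longrightarrow> 2 * d y \<le> k \<longrightarrow> key y \<le> w (ord r) y"
      using key_y[OF y(1) y'(1)] by blast+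
    moreover have "2 * d b \<le> k \<longrightarrow> 2 * d y \<le> k \<longrightarrow> key' y \<le> w b y"
      using upd[OF y(1)] y' by (auto split: if_splits)
    ultimately show ?thesis
      using key'_le[OF y(1)] ord' by (fastforce simp: less_Suc_eq)
  qed
  have 5: "key' (ord' s) \<le> dd y \<and>
       (\<forall>r<s. 2 * d (ord' r) \<le> k \<longrightarrow> 2 * d y \<le> k \<longrightarrow> key' (ord' s) \<le> w (ord' r) y)"
    if s: "s < Suc i" and y: "y < n" "y \<notin> ord' ` {..<s}" for s y
  proof (cases "s = i")
    case True
    then have yi: "y \<notin> ord ` {..<i}" using y img by simp
    \<comment> \<open>For the newly selected \<open>b\<close>, minimality gives
      \<open>key b \<le> key y\<close>, and the clause on unvisited customers bounds
      \<open>key y\<close> by the edges of \<open>y\<close>.\<close>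
    have "key' b \<le> key b" using key'_le b(1) by simp
    moreover have "key b \<le> key y" using b(3) y(1) yi by simp
    moreover have "key y \<le> dd y" "\<forall>r<i. 2 * d (ord r) \<le> k \<longrightarrow> 2 * d y \<le> k \<longrightarrow> key y \<le> w (ord r) y"
      using key_y[OF y(1) yi] by blast+
    ultimately show ?thesis using True ord' by fastforce
  next
    case False
    then have si: "s < i" using s by simp
    have ys: "y \<notin> ord ` {..<s}" using y img si by simp
    have "key (ord s) \<le> dd y"
      "\<forall>r<s. 2 * d (ord r) \<le> k \<longrightarrow> 2 * d y \<le> k \<longrightarrow> key (ord s) \<le> w (ord r) y"
      using key_s[OF si y(1) ys] by blast+
    moreover have "ord s < n" using inv si by (auto simp: prim_inv_def)
    ultimately show ?thesis
      using key'_le[of "ord s"] ord'(1) si by fastforce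
  qed
  show ?thesis unfolding prim_inv_def using 1 2 3 4 5 by simp
qed

abbreviation prim_mem :: "nat \<Rightarrow> nat \<Rightarrow> (nat \<Rightarrow> nat) \<Rightarrow> (nat \<Rightarrow> nat \<Rightarrow> real) \<Rightarrow> (nat \<Rightarrow> real) \<Rightarrow> nat \<Rightarrow>
    state \<Rightarrow> bool" where
  "prim_mem n k d w dd i s \<equiv> prim_inv n k d w dd i
     (\<lambda>t. nmem s (9, t, 0)) (\<lambda>x. nmem s (7, x, 0)) (\<lambda>x. rmem s (2, x, 0))"

lemma runs_select:
  assumes n: "nmem s (0, 0, 0) = n" and ex: "\<exists>x<n. nmem s (8, x, 0) = 0"
  shows "runs select_com s (3 + n * 4) (\<lambda>s'. rmem s' = rmem s \<and>
    (\<forall>a b c. a \<noteq> 6 \<or> b \<notin> {1, 2} \<longrightarrow> nmem s' (a, b, c) = nmem s (a, b, c)) \<and>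
    nmem s' (6, 2, 0) < n \<and> nmem s (8, nmem s' (6, 2, 0), 0) = 0 \<and>
    (\<forall>y<n. nmem s (8, y, 0) = 0 \<longrightarrow> rmem s (2, nmem s' (6, 2, 0), 0) \<le> rmem s (2, y, 0)))"
proof -
  \<comment> \<open>The second branch covers the absence of a candidate: then everything inspected
    so far is visited. At the end \<open>ex\<close> rules it out.\<close>
  let ?Q = "\<lambda>i (s' :: state). rmem s' = rmem s \<and>
    (\<forall>a b c. a \<noteq> 6 \<or> b \<notin> {1, 2} \<longrightarrow> nmem s' (a, b, c) = nmem s (a, b, c)) \<and>
    (if nmem s' (6, 2, 0) < n then nmem s (8, nmem s' (6, 2, 0), 0) = 0 \<and>
       (\<forall>y<i. nmem s (8, y, 0) = 0 \<longrightarrow> rmem s (2, nmem s' (6, 2, 0), 0) \<le> rmem s (2, y, 0))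
     else \<forall>y<i. nmem s (8, y, 0) \<noteq> 0)"
  let ?b = "BAnd (NLess (Arr 8 (Var 1)) (NConst 1))
              (BNot (BAnd (NLess (Var 2) num_customers)
                 (BNot (RLess (RArr 2 (Var 1)) (RArr 2 (Var 2))))))"
  let ?s = "set_nat 6 2 0 n s"
  have "runs (For 1 num_customers (Cond ?b (SetVar 2 (Var 1)) Skip)) ?s (2 + n * (2 + 2)) (?Q n)"
  proof (rule runs_For[where Q = ?Q])
    show "?Q 0 (set_nat 6 1 0 0 ?s)" by auto
  next
    fix i t assume i: "i < n" and Q: "?Q i t" and t: "nmem t (6, 1, 0) = i"
    have e: "nmem t (0, 0, 0) = n" "nmem t (8, i, 0) = nmem s (8, i, 0)" "rmem t = rmem s"
      using Q n by auto
    have "runs (Cond ?b (SetVar 2 (Var 1)) Skip) t (Suc 1)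
      (\<lambda>s'. nmem s' (6, 1, 0) = i \<and> ?Q (Suc i) (set_nat 6 1 0 (Suc i) s'))"
    proof (rule runs_Cond)
      assume b: "bval ?b t"
      show "runs (SetVar 2 (Var 1)) t 1
        (\<lambda>s'. nmem s' (6, 1, 0) = i \<and> ?Q (Suc i) (set_nat 6 1 0 (Suc i) s'))"
        by (rule runs_NAssign)
          (use b Q t e i in \<open>auto simp: less_Suc_eq split: if_splits intro: less_imp_le order.trans\<close>)
    next
      assume b: "\<not> bval ?b t"
      show "runs Skip t 1
        (\<lambda>s'. nmem s' (6, 1, 0) = i \<and> ?Q (Suc i) (set_nat 6 1 0 (Suc i) s'))"
        by (rule runs_Skip) (use b Q t e i in \<open>auto simp: less_Suc_eq split: if_splits\<close>)
    qed
    then show "runs (Cond ?b (SetVar 2 (Var 1)) Skip) t 2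
      (\<lambda>s'. nmem s' (6, 1, 0) = i \<and> ?Q (Suc i) (set_nat 6 1 0 (Suc i) s'))"
      by (simp add: numeral_2_eq_2)
  next
    fix i t assume "?Q i t"
    then show "nval num_customers t = n" using n by simp
  qed
  then have "runs select_com s (Suc (2 + n * (2 + 2))) (?Q n)"
    unfolding select_com_def by (intro runs_Seq_NAssign) (simp add: n)
  then show ?thesis
    by (rule runs_mono) (use ex in \<open>auto split: if_splits\<close>)
qed

lemma runs_relax:
  assumes io: "input_ok n m k d w s" and b: "nmem s (6, 2, 0) = b" "b < n"
  shows "runs relax_com s (2 + n * 5) (\<lambda>s'.
    (\<forall>x y z. x \<notin> {6, 7} \<or> (x = 6 \<and> y \<noteq> 1) \<longrightarrow> nmem s' (x, y, z) = nmem s (x, y, z)) \<and>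
    (\<forall>x y z. x \<noteq> 2 \<longrightarrow> rmem s' (x, y, z) = rmem s (x, y, z)) \<and>
    (\<forall>x<n. if nmem s (8, x, 0) = 0 \<and> 2 * d b \<le> k \<and> 2 * d x \<le> k \<and> w b x < rmem s (2, x, 0)
      then rmem s' (2, x, 0) = w b x \<and> nmem s' (7, x, 0) = Suc b
      else rmem s' (2, x, 0) = rmem s (2, x, 0) \<and> nmem s' (7, x, 0) = nmem s (7, x, 0)))"
proof -
  let ?c = "\<lambda>x. nmem s (8, x, 0) = 0 \<and> 2 * d b \<le> k \<and> 2 * d x \<le> k \<and> w b x < rmem s (2, x, 0)"
  let ?Q = "\<lambda>i (s' :: state).
    (\<forall>x y z. x \<notin> {6, 7} \<or> (x = 6 \<and> y \<noteq> 1) \<longrightarrow> nmem s' (x, y, z) = nmem s (x, y, z)) \<and>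
    (\<forall>x y z. x \<noteq> 2 \<longrightarrow> rmem s' (x, y, z) = rmem s (x, y, z)) \<and>
    (\<forall>x<n. if x < i \<and> ?c x
      then rmem s' (2, x, 0) = w b x \<and> nmem s' (7, x, 0) = Suc b
      else rmem s' (2, x, 0) = rmem s (2, x, 0) \<and> nmem s' (7, x, 0) = nmem s (7, x, 0))"
  let ?b = "BAnd (NLess (Arr 8 (Var 1)) (NConst 1))
             (BAnd (BAnd (Small (Var 2)) (Small (Var 1)))
               (RLess (RCell 0 (Var 2) (Var 1)) (RArr 2 (Var 1))))"
  let ?P = "RAssign 2 (Var 1) (NConst 0) (RCell 0 (Var 2) (Var 1)) ;;
        NAssign 7 (Var 1) (NConst 0) (NAdd (Var 2) (NConst 1))"
  have "runs relax_com s (2 + n * (3 + 2)) (?Q n)"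
    unfolding relax_com_def
  proof (rule runs_For[where Q = ?Q])
    show "?Q 0 (set_nat 6 1 0 0 s)" by simp
  next
    fix i t assume i: "i < n" and Q: "?Q i t" and t: "nmem t (6, 1, 0) = i"
    have e: "nmem t (0, 0, 2) = k" "nmem t (8, i, 0) = nmem s (8, i, 0)" "nmem t (6, 2, 0) = b"
      "nmem t (1, i, 0) = d i" "nmem t (1, b, 0) = d b" "rmem t (0, b, i) = w b i"
      "rmem t (2, i, 0) = rmem s (2, i, 0)"
      using Q io b i by (auto simp: input_ok_def)
    have c: "bval ?b t \<longleftrightarrow> ?c i" using e t by auto
    have "runs (Cond ?b ?P Skip) t (Suc (Suc 1))
      (\<lambda>s'. nmem s' (6, 1, 0) = i \<and> ?Q (Suc i) (set_nat 6 1 0 (Suc i) s'))"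
    proof (rule runs_Cond)
      assume "bval ?b t"
      then have c: "?c i" using c by blast
      show "runs ?P t (Suc 1)
        (\<lambda>s'. nmem s' (6, 1, 0) = i \<and> ?Q (Suc i) (set_nat 6 1 0 (Suc i) s'))"
        by (rule runs_Seq_RAssign, rule runs_NAssign)
          (use c Q t e[simplified] i in \<open>auto simp: less_Suc_eq\<close>)
    next
      assume "\<not> bval ?b t"
      then have c: "\<not> ?c i" using c by blast
      have "(x < Suc i \<and> ?c x) \<longleftrightarrow> (x < i \<and> ?c x)" for x using c less_Suc_eq by auto
      then have "?Q (Suc i) (set_nat 6 1 0 (Suc i) t)" using Q by simp
      then show "runs Skip t (Suc 1)
        (\<lambda>s'. nmem s' (6, 1, 0) = i \<and> ?Q (Suc i) (set_nat 6 1 0 (Suc i) s'))"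
        using t by (intro runs_Skip) auto
    qed
    then show "runs (Cond ?b ?P Skip) t 3
      (\<lambda>s'. nmem s' (6, 1, 0) = i \<and> ?Q (Suc i) (set_nat 6 1 0 (Suc i) s'))"
      by (simp add: numeral_3_eq_3)
  next
    fix i t assume "?Q i t"
    then show "nval num_customers t = n" using io by (simp add: input_ok_def)
  qed
  then show ?thesis by (rule runs_mono) auto
qed

lemma runs_prim:
  assumes io: "input_ok n m k d w s" and bl: "blank s"
    and near: "\<And>i. i < n \<Longrightarrow> nearest_ok n m w s i \<and> rmem s (2, i, 0) = rmem s (1, i, 0) \<and>
      represents n \<sigma> s i"
  shows "runs prim_com s (2 + n * (9 + n * 9)) (\<lambda>s'. input_ok n m k d w s' \<and>
    (\<forall>i<n. nearest_ok n m w s' i \<and> represents n \<sigma> s' i) \<and>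
    prim_mem n k d w (\<lambda>x. rmem s' (1, x, 0)) n s')"
proof -
  let ?dd = "\<lambda>x. rmem s (1, x, 0)"
  let ?Q = "\<lambda>i (s' :: state). input_ok n m k d w s' \<and> (\<forall>x. rmem s' (1, x, 0) = ?dd x) \<and>
    (\<forall>i<n. nearest_ok n m w s' i \<and> represents n \<sigma> s' i) \<and> prim_mem n k d w ?dd i s' \<and>
    (\<forall>x<n. nmem s' (8, x, 0) = (if x \<in> (\<lambda>t. nmem s' (9, t, 0)) ` {..<i} then 1 else 0))"
  have "runs prim_com s (2 + n * ((3 + n * 4) + (Suc (Suc (2 + n * 5))) + 2)) (?Q n)"
    unfolding prim_com_def
  proof (rule runs_For[where Q = ?Q])
    show "?Q 0 (set_nat 6 0 0 0 s)"
      using io near bl by (auto simp: prim_inv_def blank_def)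
  next
    fix i t assume i: "i < n" and Q: "?Q i t" and t: "nmem t (6, 0, 0) = i"
    let ?ord = "\<lambda>l. nmem t (9, l, 0)"
    \<comment> \<open>Only \<open>i < n\<close> customers have been visited, so by counting one is
      left to select.\<close>
    have "\<exists>x<n. x \<notin> ?ord ` {..<i}"
    proof (rule ccontr)
      assume "\<not> ?thesis"
      then have "{..<n} \<subseteq> ?ord ` {..<i}" by auto
      then have "card {..<n} \<le> card {..<i}" by (meson card_mono card_image_le finite_imageI finite_lessThan le_trans)
      then show False using i by simp
    qed
    then have ex: "\<exists>x<n. nmem t (8, x, 0) = 0" using Q by auto
    have n: "nmem t (0, 0, 0) = n" using Q by (simp add: input_ok_def)
    show "runs (select_com ;; NAssign 8 (Var 2) (NConst 0) (NConst 1) ;;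
      NAssign 9 (Var 0) (NConst 0) (Var 2) ;; relax_com) t ((3 + n * 4) + (Suc (Suc (2 + n * 5))))
      (\<lambda>s'. nmem s' (6, 0, 0) = i \<and> ?Q (Suc i) (set_nat 6 0 0 (Suc i) s'))"
    proof (rule runs_Seq, rule runs_mono[OF runs_select[OF n ex]], goal_cases)
      case (2 t2)
      define b where "b = nmem t2 (6, 2, 0)"
      have b: "b < n" "b \<notin> ?ord ` {..<i}"
        "\<And>y. y < n \<Longrightarrow> y \<notin> ?ord ` {..<i} \<Longrightarrow> rmem t (2, b, 0) \<le> rmem t (2, y, 0)"
        using 2 Q unfolding b_def[symmetric] by (auto split: if_splits)
      define t3 where "t3 = set_nat 9 i 0 b (set_nat 8 b 0 1 t2)"
      have m3: "rmem t3 = rmem t" "nmem t3 (9, i, 0) = b" "nmem t3 (6, 2, 0) = b"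
        "\<And>x y z. (x \<noteq> 6 \<or> y \<notin> {1, 2}) \<Longrightarrow> (x, y, z) \<noteq> (9, i, 0) \<Longrightarrow> (x, y, z) \<noteq> (8, b, 0) \<Longrightarrow>
           nmem t3 (x, y, z) = nmem t (x, y, z)" "nmem t3 (8, b, 0) = 1"
        using 2 unfolding t3_def b_def by auto
      have io3: "input_ok n m k d w t3"
        using Q m3 by (auto simp: input_ok_def)
      have "runs relax_com t3 (2 + n * 5)
        (\<lambda>s'. nmem s' (6, 0, 0) = i \<and> ?Q (Suc i) (set_nat 6 0 0 (Suc i) s'))"
      proof (rule runs_mono[OF runs_relax[OF io3 m3(3) b(1)]], goal_cases)
        case (2 t4)
        then have r: "\<And>x y z. x \<notin> {6, 7} \<or> (x = 6 \<and> y \<noteq> 1) \<Longrightarrow> nmem t4 (x, y, z) = nmem t3 (x, y, z)"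
          "\<And>x y z. x \<noteq> 2 \<Longrightarrow> rmem t4 (x, y, z) = rmem t (x, y, z)"
          "\<And>x. x < n \<Longrightarrow> if nmem t3 (8, x, 0) = 0 \<and> 2 * d b \<le> k \<and> 2 * d x \<le> k \<and> w b x < rmem t (2, x, 0)
            then rmem t4 (2, x, 0) = w b x \<and> nmem t4 (7, x, 0) = Suc b
            else rmem t4 (2, x, 0) = rmem t (2, x, 0) \<and> nmem t4 (7, x, 0) = nmem t (7, x, 0)"
          using m3 by auto
        have vis3: "nmem t3 (8, x, 0) = 0 \<longleftrightarrow> x \<notin> ?ord ` {..<i} \<and> x \<noteq> b" if "x < n" for x
          using Q m3(4)[of 8 x 0] m3(5) that by (cases "x = b") auto
        have ord4: "\<And>l. l < i \<Longrightarrow> nmem t4 (9, l, 0) = ?ord l" "nmem t4 (9, i, 0) = b"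
          using r(1) m3 by auto
        have prim: "prim_mem n k d w ?dd (Suc i) t4"
          using Q b ord4 r(3) vis3
          by (intro prim_inv_step[of n k d w ?dd i ?ord "\<lambda>x. nmem t (7, x, 0)" "\<lambda>x. rmem t (2, x, 0)" b])
            simp_all
        have img: "(\<lambda>l. nmem t4 (9, l, 0)) ` {..<Suc i} = insert b (?ord ` {..<i})"
          using ord4 by (auto simp: lessThan_Suc)
        have vis: "nmem t4 (8, x, 0) = (if x \<in> (\<lambda>l. nmem t4 (9, l, 0)) ` {..<Suc i} then 1 else 0)"
          if "x < n" for x
          unfolding img using Q r(1)[of 8 x 0] m3(4)[of 8 x 0] m3(5) that by (cases "x = b") auto
        have "nearest_ok n m w t4 x \<and> represents n \<sigma> t4 x" if "x < n" for x
          using Q that r(1,2) m3(4) by (auto simp: nearest_ok_def represents_def)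
        moreover have "input_ok n m k d w t4" using io3 r(1,2) m3(1) by (auto simp: input_ok_def)
        moreover have "nmem t4 (6, 0, 0) = i" using r(1) m3(4) t by auto
        ultimately show ?case using prim vis r(2) Q by simp
      qed auto
      then have "runs (NAssign 8 (Var 2) (NConst 0) (NConst 1) ;;
        NAssign 9 (Var 0) (NConst 0) (Var 2) ;; relax_com) t2 (Suc (Suc (2 + n * 5)))
        (\<lambda>s'. nmem s' (6, 0, 0) = i \<and> ?Q (Suc i) (set_nat 6 0 0 (Suc i) s'))"
        by (intro runs_Seq_NAssign) (use 2 t in \<open>simp add: t3_def b_def\<close>)
      then show ?case .
    qed auto
  next
    fix i t assume "?Q i t"
    then show "nval num_customers t = n" by (simp add: input_ok_def)
  qed
  then show ?thesis by (rule runs_mono) (auto simp: algebra_simps)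
qed

section \<open>Bag operations on the machine\<close>

lemma runs_append:
  assumes "nmem s (6, 3, 0) = v" "nmem s (6, 4, 0) = r" "r \<noteq> v"
    and "nmem s (12, v, 0) = lv" "nmem s (12, r, 0) = lr"
  shows "runs append_com s (2 + lv * 3) (\<lambda>s'. rmem s' = rmem s \<and>
    (\<forall>a b c. nmem s' (a, b, c) = (if (a, b, c) = (6, 1, 0) then lv
       else if a = 13 \<and> b = r \<and> lr \<le> c \<and> c < lr + lv then nmem s (13, v, c - lr)
       else nmem s (a, b, c))))"
proof -
  let ?Q = "\<lambda>i (s' :: state). rmem s' = rmem s \<and>
    (\<forall>a b c. nmem s' (a, b, c) = (if (a, b, c) = (6, 1, 0) then i
       else if a = 13 \<and> b = r \<and> lr \<le> c \<and> c < lr + i then nmem s (13, v, c - lr)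
       else nmem s (a, b, c)))"
  have "runs append_com s (2 + lv * (1 + 2)) (?Q lv)"
    unfolding append_com_def
    by (rule runs_For[where Q = ?Q]; (rule runs_NAssign)?) (use assms in auto)
  then show ?thesis by (rule runs_mono) (simp, assumption)
qed

lemma runs_add_units:
  assumes "nmem s (6, 3, 0) = v" "nmem s (6, 4, 0) = r" "r \<noteq> v" "nmem s (0, 0, 0) = n"
  shows "runs add_units_com s (2 + n * 3) (\<lambda>s'. rmem s' = rmem s \<and>
    (\<forall>a b c. nmem s' (a, b, c) = (if (a, b, c) = (6, 1, 0) then n
       else if a = 14 \<and> b = r \<and> c < n then nmem s (14, r, c) + nmem s (14, v, c)
       else nmem s (a, b, c))))"
proof -
  let ?Q = "\<lambda>i (s' :: state). rmem s' = rmem s \<and>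
    (\<forall>a b c. nmem s' (a, b, c) = (if (a, b, c) = (6, 1, 0) then i
       else if a = 14 \<and> b = r \<and> c < i then nmem s (14, r, c) + nmem s (14, v, c)
       else nmem s (a, b, c)))"
  have "runs add_units_com s (2 + n * (1 + 2)) (?Q n)"
    unfolding add_units_com_def
    by (rule runs_For[where Q = ?Q]; (rule runs_NAssign)?) (use assms in auto)
  then show ?thesis by (rule runs_mono) (simp, assumption)
qed

lemma runs_merge:
  assumes v: "nmem s (6, 3, 0) = v" "nmem s (7, v, 0) = Suc r" "r \<noteq> v" "r < n" "v < n"
    and n: "nmem s (0, 0, 0) = n"
    and rep: "\<And>i. i < n \<Longrightarrow> represents n \<sigma> s i"
  shows "runs merge_com s (8 + 3 * length (bag_walk \<sigma> v) + 3 * n) (\<lambda>s'. rmem s' = rmem s \<and>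
    (\<forall>a b c. a \<notin> {6, 11, 12, 13, 14} \<or> (a = 6 \<and> b \<notin> {1, 4}) \<longrightarrow> nmem s' (a, b, c) = nmem s (a, b, c)) \<and>
    nmem s' (6, 4, 0) = r \<and> (\<forall>i<n. represents n (merge_bags r v \<sigma>) s' i))"
    (is "runs _ _ _ ?P")
proof -
  let ?lv = "length (bag_walk \<sigma> v)" and ?lr = "length (bag_walk \<sigma> r)"
  let ?s = "set_nat 6 4 0 r s"
  have l: "nmem s (12, v, 0) = ?lv" "nmem s (12, r, 0) = ?lr"
    using rep[OF v(4)] rep[OF v(5)] by (auto simp: represents_def)
  have 1: "runs (NAssign 13 (Var 4) (NAdd (Arr 12 (Var 4)) (Arr 12 (Var 3))) (Var 4) ;;
     NAssign 12 (Var 4) (NConst 0) (NAdd (NAdd (Arr 12 (Var 4)) (Arr 12 (Var 3))) (NConst 1)) ;;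
     add_units_com ;;
     NAssign 11 (Var 4) (NConst 0) (NAdd (Arr 11 (Var 4)) (Arr 11 (Var 3)))) t
       (Suc (Suc ((2 + n * 3) + 1))) ?P"
    if t: "rmem t = rmem s" "\<And>a b c. nmem t (a, b, c) = (if (a, b, c) = (6, 1, 0) then ?lv
       else if a = 13 \<and> b = r \<and> ?lr \<le> c \<and> c < ?lr + ?lv then nmem ?s (13, v, c - ?lr)
       else nmem ?s (a, b, c))" for t
  proof -
    let ?t = "set_nat 12 r 0 (Suc (?lr + ?lv)) (set_nat 13 r (?lr + ?lv) r t)"
    have "runs (add_units_com ;; NAssign 11 (Var 4) (NConst 0) (NAdd (Arr 11 (Var 4)) (Arr 11 (Var 3))))
       ?t ((2 + n * 3) + 1) ?P"
    proof (rule runs_Seq, rule runs_mono[OF runs_add_units[where n = n and r = r and v = v]], goal_cases)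
      case (6 u)
      have u: "nmem u (6, 3, 0) = v" "nmem u (6, 4, 0) = r" "nmem u (11, r, 0) = bag_load \<sigma> r"
        "nmem u (11, v, 0) = bag_load \<sigma> v"
        using 6 t v rep[OF v(4)] rep[OF v(5)] by (auto simp: represents_def)
      let ?u = "set_nat 11 r 0 (bag_load \<sigma> r + bag_load \<sigma> v) u"
      have "represents n (merge_bags r v \<sigma>) ?u i" if i: "i < n" for i
      proof (cases "i = r")
        case True
        have "nmem ?u (13, r, q) = (bag_walk \<sigma> r @ bag_walk \<sigma> v @ [r]) ! q"
          if "q < ?lr + ?lv + 1" for q
          using 6 t v rep[OF v(4)] rep[OF v(5)] that
          by (auto simp: represents_def nth_append)
        then show ?thesis
          using 6 t v rep[OF v(4)] rep[OF v(5)] True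
          by (auto simp: represents_def merge_bags_def)
      next
        case False
        then show ?thesis using 6 t v rep[OF i] by (auto simp: represents_def merge_bags_def)
      qed
      then have "?P ?u" using 6 t u by auto
      then show ?case by (intro runs_NAssign) (simp_all add: u)
    qed (use t v n in auto)
    then show ?thesis
      by (intro runs_Seq_NAssign) (use t v l in simp)
  qed
  have "runs merge_com s (Suc ((2 + ?lv * 3) + Suc (Suc ((2 + n * 3) + 1)))) ?P"
    unfolding merge_com_def
  proof (rule runs_Seq_NAssign)
    show "runs (append_com ;; NAssign 13 (Var 4) (NAdd (Arr 12 (Var 4)) (Arr 12 (Var 3))) (Var 4) ;;
     NAssign 12 (Var 4) (NConst 0) (NAdd (NAdd (Arr 12 (Var 4)) (Arr 12 (Var 3))) (NConst 1)) ;;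
     add_units_com ;;
     NAssign 11 (Var 4) (NConst 0) (NAdd (Arr 11 (Var 4)) (Arr 11 (Var 3))))
     (set_nat 6 (nval (NConst 4) s) (nval (NConst 0) s) (nval (NSub (Arr 7 (Var 3)) (NConst 1)) s) s)
     ((2 + ?lv * 3) + Suc (Suc ((2 + n * 3) + 1))) ?P"
      by (rule runs_Seq, rule runs_mono[OF runs_append[where r = r and v = v and lv = ?lv and lr = ?lr]])
        (use v l 1 in auto)
  qed
  then show ?thesis by (rule runs_mono) auto
qed

lemma runs_best:
  assumes r: "nmem s (6, 4, 0) = r" "nmem s (12, r, 0) = length l"
    and l: "\<And>q. q < length l \<Longrightarrow> nmem s (13, r, q) = l ! q" "l \<noteq> []"
  shows "runs best_com s (3 + length l * 4) (\<lambda>s'. rmem s' = rmem s \<and>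
    (\<forall>a b c. a \<noteq> 6 \<or> b \<notin> {1, 5} \<longrightarrow> nmem s' (a, b, c) = nmem s (a, b, c)) \<and>
    nmem s' (6, 5, 0) < length l \<and>
    (\<forall>y\<in>set l. rmem s (1, l ! nmem s' (6, 5, 0), 0) \<le> rmem s (1, y, 0)))"
proof -
  let ?Q = "\<lambda>i (s' :: state). rmem s' = rmem s \<and>
    (\<forall>a b c. a \<noteq> 6 \<or> b \<notin> {1, 5} \<longrightarrow> nmem s' (a, b, c) = nmem s (a, b, c)) \<and>
    nmem s' (6, 5, 0) < length l \<and>
    (\<forall>q<i. rmem s (1, l ! nmem s' (6, 5, 0), 0) \<le> rmem s (1, l ! q, 0))"
  let ?b = "RLess (RArr 1 (NCell 13 (Var 4) (Var 1))) (RArr 1 (NCell 13 (Var 4) (Var 5)))"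
  have "runs (For 1 (Arr 12 (Var 4)) (Cond ?b (SetVar 5 (Var 1)) Skip)) (set_nat 6 5 0 0 s)
    (2 + length l * (Suc 1 + 2)) (?Q (length l))"
  proof (rule runs_For[where Q = ?Q])
    show "?Q 0 (set_nat 6 1 0 0 (set_nat 6 5 0 0 s))" using l by auto
  next
    fix i t assume i: "i < length l" and Q: "?Q i t" and t: "nmem t (6, 1, 0) = i"
    have e: "nmem t (6, 4, 0) = r" "nmem t (13, r, i) = l ! i"
      "nmem t (13, r, nmem t (6, 5, 0)) = l ! nmem t (6, 5, 0)"
      using Q r l i by auto
    show "runs (Cond ?b (SetVar 5 (Var 1)) Skip) t (Suc 1)
      (\<lambda>s'. nmem s' (6, 1, 0) = i \<and> ?Q (Suc i) (set_nat 6 1 0 (Suc i) s'))"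
    proof (rule runs_Cond)
      assume b: "bval ?b t"
      show "runs (SetVar 5 (Var 1)) t 1
        (\<lambda>s'. nmem s' (6, 1, 0) = i \<and> ?Q (Suc i) (set_nat 6 1 0 (Suc i) s'))"
        by (rule runs_NAssign)
          (use b Q t e i in \<open>auto simp: less_Suc_eq intro: less_imp_le order.trans\<close>)
    next
      assume b: "\<not> bval ?b t"
      show "runs Skip t 1
        (\<lambda>s'. nmem s' (6, 1, 0) = i \<and> ?Q (Suc i) (set_nat 6 1 0 (Suc i) s'))"
        by (rule runs_Skip) (use b Q t e i in \<open>auto simp: less_Suc_eq\<close>)
    qed
  next
    fix i t assume "?Q i t"
    then show "nval (Arr 12 (Var 4)) t = length l" using r by auto
  qed
  then have "runs best_com s (Suc (2 + length l * (Suc 1 + 2))) (?Q (length l))"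
    unfolding best_com_def by (intro runs_Seq_NAssign) simp
  then show ?thesis
    by (rule runs_mono) (auto simp: in_set_conv_nth)
qed

lemma runs_write_walk:
  assumes r: "nmem s (6, 3, 0) = v" "nmem s (6, 4, 0) = r" "nmem s (6, 5, 0) = x"
    "nmem s (12, r, 0) = length l"
    and l: "\<And>q. q < length l \<Longrightarrow> nmem s (13, r, q) = l ! q" and x: "x < length l"
  shows "runs write_walk_com s (2 + length l * 4) (\<lambda>s'. rmem s' = rmem s \<and>
    (\<forall>a b c. nmem s' (a, b, c) = (if (a, b, c) = (6, 1, 0) then length l
       else if a = 4 \<and> b = v \<and> 0 < c \<and> c \<le> length l then rotate_closed x l ! (c - 1)
       else nmem s (a, b, c))))"
proof -
  let ?Q = "\<lambda>i (s' :: state). rmem s' = rmem s \<and>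
    (\<forall>a b c. nmem s' (a, b, c) = (if (a, b, c) = (6, 1, 0) then i
       else if a = 4 \<and> b = v \<and> 0 < c \<and> c \<le> i then rotate_closed x l ! (c - 1)
       else nmem s (a, b, c)))"
  have "runs write_walk_com s (2 + length l * (Suc 1 + 2)) (?Q (length l))"
    unfolding write_walk_com_def
  proof (rule runs_For[where Q = ?Q])
    show "?Q 0 (set_nat 6 1 0 0 s)" by auto
  next
    fix i t assume i: "i < length l" and Q: "?Q i t" and t: "nmem t (6, 1, 0) = i"
    have e: "nmem t (6, 3, 0) = v" "nmem t (6, 4, 0) = r" "nmem t (6, 5, 0) = x"
      "nmem t (12, r, 0) = length l" "\<And>q. q < length l \<Longrightarrow> nmem t (13, r, q) = l ! q"
      using Q r l by auto
    have Q': "?Q (Suc i) (set_nat 6 1 0 (Suc i) (set_nat 4 v (Suc i) (rotate_closed x l ! i) t))"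
      using Q by (auto simp: le_Suc_eq)
    note rot = nth_rotate_closed[OF x i]
    show "runs (Cond (NLess (NAdd (Var 5) (Var 1)) (Arr 12 (Var 4)))
       (NAssign 4 (Var 3) (NAdd (Var 1) (NConst 1)) (NCell 13 (Var 4) (NAdd (Var 5) (Var 1))))
       (NAssign 4 (Var 3) (NAdd (Var 1) (NConst 1))
          (NCell 13 (Var 4) (NSub (NAdd (NAdd (Var 5) (Var 1)) (NConst 1)) (Arr 12 (Var 4))))))
       t (Suc 1) (\<lambda>s'. nmem s' (6, 1, 0) = i \<and> ?Q (Suc i) (set_nat 6 1 0 (Suc i) s'))"
    proof (rule runs_Cond; rule runs_NAssign)
      assume "bval (NLess (NAdd (Var 5) (Var 1)) (Arr 12 (Var 4))) t"
      then have "x + i < length l" using e t by simp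
      then have v: "set_nat 4 (nval (Var 3) t) (nval (NAdd (Var 1) (NConst 1)) t)
          (nval (NCell 13 (Var 4) (NAdd (Var 5) (Var 1))) t) t
        = set_nat 4 v (Suc i) (rotate_closed x l ! i) t"
        using e t[simplified] rot by simp
      show "nmem (set_nat 4 (nval (Var 3) t) (nval (NAdd (Var 1) (NConst 1)) t)
          (nval (NCell 13 (Var 4) (NAdd (Var 5) (Var 1))) t) t) (6, 1, 0) = i \<and>
        ?Q (Suc i) (set_nat 6 1 0 (Suc i) (set_nat 4 (nval (Var 3) t) (nval (NAdd (Var 1) (NConst 1)) t)
          (nval (NCell 13 (Var 4) (NAdd (Var 5) (Var 1))) t) t))"
        unfolding v using Q' t by simp
    next
      assume "\<not> bval (NLess (NAdd (Var 5) (Var 1)) (Arr 12 (Var 4))) t"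
      then have c: "\<not> x + i < length l" using e t by simp
      have v: "set_nat 4 (nval (Var 3) t) (nval (NAdd (Var 1) (NConst 1)) t)
          (nval (NCell 13 (Var 4) (NSub (NAdd (NAdd (Var 5) (Var 1)) (NConst 1)) (Arr 12 (Var 4)))) t) t
        = set_nat 4 v (Suc i) (rotate_closed x l ! i) t"
        using e t[simplified] rot c x i by simp
      show "nmem (set_nat 4 (nval (Var 3) t) (nval (NAdd (Var 1) (NConst 1)) t)
          (nval (NCell 13 (Var 4) (NSub (NAdd (NAdd (Var 5) (Var 1)) (NConst 1)) (Arr 12 (Var 4)))) t) t)
          (6, 1, 0) = i \<and>
        ?Q (Suc i) (set_nat 6 1 0 (Suc i) (set_nat 4 (nval (Var 3) t) (nval (NAdd (Var 1) (NConst 1)) t)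
          (nval (NCell 13 (Var 4) (NSub (NAdd (NAdd (Var 5) (Var 1)) (NConst 1)) (Arr 12 (Var 4)))) t) t))"
        unfolding v using Q' t by simp
    qed simp_all
  next
    fix i t assume "?Q i t"
    then show "nval (Arr 12 (Var 4)) t = length l" using r by simp
  qed
  then show ?thesis by (rule runs_mono) (simp, assumption)
qed

lemma runs_write_units:
  assumes "nmem s (6, 3, 0) = v" "nmem s (6, 4, 0) = r" "nmem s (0, 0, 0) = n"
  shows "runs write_units_com s (2 + n * 4) (\<lambda>s'. rmem s' = rmem s \<and>
    (\<forall>a b c. nmem s' (a, b, c) = (if (a, b, c) = (6, 1, 0) then n
       else if a = 5 \<and> b = v \<and> c < n then nmem s (14, r, c)
       else if a = 14 \<and> b = r \<and> c < n then 0
       else nmem s (a, b, c))))"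
proof -
  let ?Q = "\<lambda>i (s' :: state). rmem s' = rmem s \<and>
    (\<forall>a b c. nmem s' (a, b, c) = (if (a, b, c) = (6, 1, 0) then i
       else if a = 5 \<and> b = v \<and> c < i then nmem s (14, r, c)
       else if a = 14 \<and> b = r \<and> c < i then 0
       else nmem s (a, b, c)))"
  have "runs write_units_com s (2 + n * (Suc 1 + 2)) (?Q n)"
    unfolding write_units_com_def
    by (rule runs_For[where Q = ?Q]; (rule runs_Seq_NAssign, rule runs_NAssign)?) (use assms in auto)
  then show ?thesis by (rule runs_mono) (simp, assumption)
qed

lemma inj_on_notin_image_lessThan:
  assumes "inj_on f {..<n}" "t < n" "s \<le> t"
  shows "f t \<notin> f ` {..<s :: nat}"
proof
  assume "f t \<in> f ` {..<s}"
  then obtain x where "x < s" "f t = f x" by auto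
  then show False using inj_onD[OF assms(1), of t x] assms(2,3) by auto
qed

lemma nth_depot_tour:
  assumes "x < length l" "q < length l + 2"
  shows "depot_tour nd x l ! q
    = (if 0 < q \<and> q \<le> length l then rotate_closed x l ! (q - 1) else nd (l ! x))"
  using assms length_rotate_closed[of x l]
  by (auto simp: depot_tour_def nth_append nth_Cons split: nat.splits)

text \<open>Each walk entry is scanned once for the nearest depot and copied once, four steps each.
  Among equally near vertices the choice depends on the scan, so the conclusion only promises some
  minimising position \<open>x\<close>.\<close>

lemma runs_emit:
  fixes s :: state
  defines "dd \<equiv> \<lambda>i. rmem s (1, i, 0)" and "nd \<equiv> \<lambda>i. nmem s (10, i, 0)"
  assumes v: "nmem s (6, 3, 0) = v" "nmem s (6, 4, 0) = r" "r < n" "v < n"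
    and n: "nmem s (0, 0, 0) = n"
    and rep: "\<And>i. i < n \<Longrightarrow> represents n \<sigma> s i"
    and l: "bag_walk \<sigma> r \<noteq> []" "hd (bag_walk \<sigma> r) = r"
  shows "runs emit_com s (12 + 8 * length (bag_walk \<sigma> r) + 4 * n) (\<lambda>s'. rmem s' = rmem s \<and>
    (\<forall>a b c. a \<notin> {3, 4, 5, 6, 11, 12, 14} \<or> (a = 6 \<and> b \<notin> {1, 5}) \<longrightarrow> nmem s' (a, b, c) = nmem s (a, b, c)) \<and>
    (\<exists>x<length (bag_walk \<sigma> r). (\<forall>y\<in>set (bag_walk \<sigma> r). dd (bag_walk \<sigma> r ! x) \<le> dd y) \<and>
      (\<forall>i<n. represents n (emit_bag nd x r v \<sigma>) s' i)))"
    (is "runs _ _ _ ?P")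
proof -
  define l where "l = bag_walk \<sigma> r"
  have repr: "nmem s (12, r, 0) = length l" "\<And>q. q < length l \<Longrightarrow> nmem s (13, r, q) = l ! q"
    using rep[OF v(3)] by (auto simp: represents_def l_def)
  have l0: "l \<noteq> []" "l ! 0 = r" using l by (simp_all add: l_def hd_conv_nth)
  have tail: "runs (NAssign 4 (Var 3) (NConst 0) (Arr 10 (NCell 13 (Var 4) (Var 5))) ;;
     write_walk_com ;;
     NAssign 4 (Var 3) (NAdd (Arr 12 (Var 4)) (NConst 1)) (NCell 4 (Var 3) (NConst 0)) ;;
     NAssign 3 (Var 3) (NConst 0) (NAdd (Arr 12 (Var 4)) (NConst 2)) ;;
     write_units_com ;;
     NAssign 11 (Var 4) (NConst 0) (NConst 0) ;;
     NAssign 12 (Var 4) (NConst 0) (NConst 1)) s1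
     (Suc ((2 + length l * 4) + Suc (Suc ((2 + n * 4) + Suc 1)))) ?P"
    if s1: "rmem s1 = rmem s"
      "\<And>a b c. a \<noteq> 6 \<or> b \<notin> {1, 5} \<Longrightarrow> nmem s1 (a, b, c) = nmem s (a, b, c)"
      "nmem s1 (6, 5, 0) = x" "x < length l" "\<forall>y\<in>set l. dd (l ! x) \<le> dd y" for s1 x
  proof -
    define s2 where "s2 = set_nat 4 v 0 (nd (l ! x)) s1"
    have "runs (write_walk_com ;;
     NAssign 4 (Var 3) (NAdd (Arr 12 (Var 4)) (NConst 1)) (NCell 4 (Var 3) (NConst 0)) ;;
     NAssign 3 (Var 3) (NConst 0) (NAdd (Arr 12 (Var 4)) (NConst 2)) ;;
     write_units_com ;;
     NAssign 11 (Var 4) (NConst 0) (NConst 0) ;;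
     NAssign 12 (Var 4) (NConst 0) (NConst 1)) s2
     ((2 + length l * 4) + Suc (Suc ((2 + n * 4) + Suc 1))) ?P"
    proof (rule runs_Seq, rule runs_mono[OF runs_write_walk[where v = v and r = r and x = x and l = l]], goal_cases)
      case (8 s3)
      define s4 where "s4 = set_nat 3 v 0 (length l + 2) (set_nat 4 v (Suc (length l)) (nd (l ! x)) s3)"
      have e3: "nmem s3 (6, 3, 0) = v" "nmem s3 (6, 4, 0) = r" "nmem s3 (12, r, 0) = length l"
        "nmem s3 (4, v, 0) = nd (l ! x)"
        using 8 s1 v repr by (auto simp: s2_def)
      have "runs (write_units_com ;;
        NAssign 11 (Var 4) (NConst 0) (NConst 0) ;;
        NAssign 12 (Var 4) (NConst 0) (NConst 1)) s4 ((2 + n * 4) + Suc 1) ?P"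
      proof (rule runs_Seq, rule runs_mono[OF runs_write_units[where v = v and r = r and n = n]], goal_cases)
        case (5 s5)
        define s6 where "s6 = set_nat 12 r 0 1 (set_nat 11 r 0 0 s5)"
        have m5: "nmem s5 (a, b, c) = (if (a, b, c) = (6, 1, 0) then n
          else if a = 5 \<and> b = v \<and> c < n then nmem s (14, r, c)
          else if a = 14 \<and> b = r \<and> c < n then 0
          else if (a, b, c) = (3, v, 0) then length l + 2
          else if a = 4 \<and> b = v \<and> c = 0 then nd (l ! x)
          else if a = 4 \<and> b = v \<and> c = Suc (length l) then nd (l ! x)
          else if a = 4 \<and> b = v \<and> 0 < c \<and> c \<le> length l then rotate_closed x l ! (c - 1)
          else nmem s (a, b, c))" if "a = 6 \<longrightarrow> b \<notin> {1, 5}" for a b c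
          using that 5 8 s1 by (auto simp: s4_def s2_def)
        have "represents n (emit_bag nd x r v \<sigma>) s6 i" if i: "i < n" for i
        proof -
          have "length (depot_tour nd x l) = length l + 2"
            using length_rotate_closed[OF s1(4)] by (simp add: depot_tour_def)
          moreover have "nmem s6 (4, v, q) = depot_tour nd x l ! q" if "q < length l + 2" for q
            using that nth_depot_tour[OF s1(4) that] by (auto simp: s6_def m5)
          ultimately show ?thesis
            using rep[OF i] rep[OF v(3)] repr l0 l_def
            by (cases "i = r"; cases "i = v")
              (auto simp: represents_def emit_bag_def s6_def m5)
        qed
        moreover have "rmem s6 = rmem s" using 5 8 s1(1) by (simp add: s6_def s4_def s2_def)
        moreover have "\<forall>a b c. a \<notin> {3, 4, 5, 6, 11, 12, 14} \<or> (a = 6 \<and> b \<notin> {1, 5}) \<longrightarrow>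
            nmem s6 (a, b, c) = nmem s (a, b, c)"
          by (auto simp: s6_def m5)
        ultimately have "?P s6" using s1(4,5) unfolding l_def by blast
        moreover have "nmem s5 (6, 4, 0) = r" using v by (simp add: m5)
        ultimately show ?case
          by (intro runs_Seq_NAssign runs_NAssign) (simp_all add: s6_def)
      qed (use e3 8 s1 n v in \<open>auto simp: s4_def s2_def\<close>)
      then show ?case
        by (intro runs_Seq_NAssign) (use e3 in \<open>simp add: s4_def\<close>)
    qed (use s1 v repr in \<open>auto simp: s2_def\<close>)
    moreover have "nmem s1 (10, l ! x, 0) = nd (l ! x)" using s1(2) by (simp add: nd_def)
    ultimately show ?thesis
      by (intro runs_Seq_NAssign) (use s1 v repr in \<open>simp add: s2_def\<close>)
  qed
  have "runs emit_com s
    ((3 + length l * 4) + (Suc ((2 + length l * 4) + Suc (Suc ((2 + n * 4) + Suc 1))))) ?P"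
    unfolding emit_com_def
  proof (rule runs_Seq, rule runs_mono[OF runs_best[where r = r and l = l]], goal_cases)
    case (6 s1)
    then show ?case by (intro tail) (auto simp: dd_def)
  qed (use v repr l0 in auto)
  then show ?thesis by (rule runs_mono) (simp add: l_def, assumption)
qed

lemma runs_keep:
  assumes v: "nmem s (6, 3, 0) = v" "nmem s (0, 0, 0) = n"
    and rep: "\<And>i. i < n \<Longrightarrow> represents n \<sigma> s i"
  shows "runs keep_com s 2 (\<lambda>s'. rmem s' = rmem s \<and>
    (\<forall>a b c. a \<notin> {3, 4} \<longrightarrow> nmem s' (a, b, c) = nmem s (a, b, c)) \<and>
    (\<forall>i<n. represents n (keep_bag n v \<sigma>) s' i))" (is "runs _ _ _ ?P")
proof -
  have "?P (set_nat 4 v 0 n (set_nat 3 v 0 1 s))"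
    using rep by (auto simp: represents_def keep_bag_def)
  then have "runs keep_com s (Suc 1) ?P"
    unfolding keep_com_def by (intro runs_Seq_NAssign runs_NAssign) (simp_all add: v)
  then show ?thesis by (simp add: numeral_2_eq_2)
qed

lemma (in bag_setup) runs_bag:
  assumes io: "input_ok n m k d w s" and rep: "\<And>i. i < n \<Longrightarrow> represents n (initial_bags d) s i"
    and mem: "\<And>i. nmem s (7, i, 0) = par i" "\<And>i. nmem s (9, i, 0) = ord i"
      "\<And>i. nmem s (10, i, 0) = nd i" "\<And>i. rmem s (1, i, 0) = dd i"
  shows "runs bag_com s (2 + n * (25 + 29 * n)) (\<lambda>s'. nmem s' (0, 0, 0) = n \<and>
    (\<exists>\<sigma>. bag_inv {} \<sigma> \<and> (\<forall>i<n. represents n \<sigma> s' i)))"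
proof -
  \<comment> \<open>Iteration \<open>i\<close> processes position \<open>n - i - 1\<close> of the
    Prim order; the customers still active before it are the first \<open>n - i\<close>.\<close>
  let ?Q = "\<lambda>i (s' :: state). rmem s' = rmem s \<and>
    (\<forall>a b c. a \<in> {0, 1, 7, 9, 10} \<longrightarrow> nmem s' (a, b, c) = nmem s (a, b, c)) \<and>
    (\<exists>\<sigma>. bag_inv (ord ` {..<n - i}) \<sigma> \<and> (\<forall>j<n. represents n \<sigma> s' j))"
  let ?M = "Cond (NLess (NConst 0) (Arr 7 (Var 3))) merge_com (SetVar 4 (Var 3))"
  let ?E = "Cond (BAnd (NLess (NConst 0) (Arr 7 (Var 3)))
             (BNot (NLess cap (NAdd (Arr 11 (Var 4)) (Arr 11 (Var 4))))))
        keep_com emit_com"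
  \<comment> \<open>The budget bounds active walks by \<open>2 * n\<close>: a merge then takes at
    most \<open>8 + 3 * 2n + 3n\<close> steps and an emission at most
    \<open>12 + 8 * 2n + 4n\<close>.\<close>
  let ?T = "Suc (Suc (8 + 9 * n) + Suc (12 + 20 * n))"
  have "runs bag_com s (2 + n * (?T + 2)) (?Q n)"
    unfolding bag_com_def
  proof (rule runs_For[where Q = ?Q])
    show "?Q 0 (set_nat 6 0 0 0 s)"
      using rep inv_initial bij_betw_imp_surj_on[OF ord] by auto
  next
    fix i t assume i: "i < n" and Q: "?Q i t" and t: "nmem t (6, 0, 0) = i"
    define p where "p = n - i - 1"
    define U where "U = ord ` {..<n - i}"
    define v where "v = ord p"
    have p: "p < n" "n - i = Suc p" using i by (auto simp: p_def)
    from Q obtain \<sigma> where inv: "bag_inv U \<sigma>" and rep: "\<And>j. j < n \<Longrightarrow> represents n \<sigma> t j"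
      unfolding U_def by blast
    have inj: "inj_on ord {..<n}" using ord by (simp add: bij_betw_def)
    have Un: "U \<subseteq> {..<n}"
      using ord image_mono[of "{..<n - i}" "{..<n}" ord] by (simp add: U_def bij_betw_def)
    have vU: "v \<in> U" "v < n" using p Un unfolding U_def v_def by auto
    have U': "ord ` {..<n - Suc i} = U - {v}"
    proof -
      have "n - Suc i = p" using p by simp
      moreover have "ord p \<notin> ord ` {..<p}"
        by (rule inj_on_notin_image_lessThan[OF inj p(1)]) simp
      ultimately show ?thesis unfolding U_def v_def p(2) by (auto simp: lessThan_Suc)
    qed
    have fin: "finite U" by (simp add: U_def)
    have len: "length (bag_walk \<sigma> u) \<le> 2 * n" if "u \<in> U" for u
      using inv member_le_sum[OF that, of "\<lambda>u. length (bag_walk \<sigma> u)"] fin by (simp add: bag_inv_def)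
    have mt: "nmem t (0, 0, 0) = n" "nmem t (0, 0, 2) = k" "nmem t (7, v, 0) = par v"
      "nmem t (9, p, 0) = v" "\<And>i. nmem t (10, i, 0) = nd i" "\<And>i. rmem t (1, i, 0) = dd i"
      using Q io mem by (auto simp: input_ok_def v_def)
    define t1 where "t1 = set_nat 6 3 0 v t"
    have goal: "nmem s' (6, 0, 0) = i \<and> ?Q (Suc i) (set_nat 6 0 0 (Suc i) s')"
      if "rmem s' = rmem t"
        "\<And>a b c. a \<notin> {3, 4, 5, 6, 11, 12, 13, 14} \<or> (a = 6 \<and> b = 0) \<Longrightarrow> nmem s' (a, b, c) = nmem t (a, b, c)"
        "bag_inv (U - {v}) \<sigma>'" "\<And>j. j < n \<Longrightarrow> represents n \<sigma>' s' j" for s' \<sigma>'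
      using that Q t unfolding U' by auto
    have best: "best x l \<longleftrightarrow> x < length l \<and> (\<forall>y\<in>set l. dd (l ! x) \<le> dd y)" for x l
      by (simp add: best_def)
    have "runs (?M ;; ?E) t1 (Suc (8 + 9 * n) + Suc (12 + 20 * n))
      (\<lambda>s'. nmem s' (6, 0, 0) = i \<and> ?Q (Suc i) (set_nat 6 0 0 (Suc i) s'))"
    proof (cases "par v = 0")
      case True
      then have kd: "key v = dd v" using par[OF p(1)] unfolding v_def by auto
      have bag: "closed_walk n v (bag_walk \<sigma> v)" using inv vU by (simp add: bag_inv_def bag_ok_def)
      define t2 where "t2 = set_nat 6 4 0 v t1"
      have rep2: "\<And>j. j < n \<Longrightarrow> represents n \<sigma> t2 j" using rep by (simp add: t2_def t1_def)
      have "runs emit_com t2 (12 + 8 * length (bag_walk \<sigma> v) + 4 * n)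
        (\<lambda>s'. nmem s' (6, 0, 0) = i \<and> ?Q (Suc i) (set_nat 6 0 0 (Suc i) s'))"
      proof (rule runs_mono[OF runs_emit[where v = v and r = v and n = n and \<sigma> = \<sigma>]], goal_cases)
        case (10 s')
        then obtain x where x: "best x (bag_walk \<sigma> v)"
          "\<And>j. j < n \<Longrightarrow> represents n (emit_bag nd x v v \<sigma>) s' j"
          unfolding best using mt(5,6) by (auto simp: t2_def t1_def)
        have f: "rmem s' = rmem t" using 10 by (simp add: t2_def t1_def)
        have "nmem s' (a, b, c) = nmem t (a, b, c)"
          if "a \<notin> {3, 4, 5, 6, 11, 12, 13, 14} \<or> (a = 6 \<and> b = 0)" for a b c
        proof -
          have "nmem s' (a, b, c) = nmem t2 (a, b, c)" using 10 that by auto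
          then show ?thesis using that by (auto simp: t2_def t1_def)
        qed
        then show ?case by (rule goal[OF f _ inv_root_step[OF inv Un vU(1) kd x(1)] x(2)])
      qed (use vU mt(1) rep2 bag in \<open>auto simp: t2_def t1_def closed_walk_def\<close>)
      then have "runs emit_com t2 (12 + 20 * n)
        (\<lambda>s'. nmem s' (6, 0, 0) = i \<and> ?Q (Suc i) (set_nat 6 0 0 (Suc i) s'))"
        by (rule runs_mono) (use len[OF vU(1)] in auto)
      then have E: "runs ?E t2 (Suc (12 + 20 * n))
        (\<lambda>s'. nmem s' (6, 0, 0) = i \<and> ?Q (Suc i) (set_nat 6 0 0 (Suc i) s'))"
        by (intro runs_Cond) (use True mt(3) in \<open>auto simp: t2_def t1_def\<close>)
      have "runs ?M t1 (Suc (8 + 9 * n)) (\<lambda>s'. runs ?E s' (Suc (12 + 20 * n))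
        (\<lambda>s'. nmem s' (6, 0, 0) = i \<and> ?Q (Suc i) (set_nat 6 0 0 (Suc i) s')))"
        by (rule runs_Cond; (rule runs_NAssign)?) (use E True mt(3) in \<open>auto simp: t2_def t1_def\<close>)
      then show ?thesis by (rule runs_Seq)
    next
      case False
      then obtain q where q: "q < p" "par v = Suc (ord q)" "key v = w (ord q) v"
        "2 * d (ord q) \<le> k" "2 * d v \<le> k"
        using par[OF p(1)] unfolding v_def by metis
      define r where "r = ord q"
      note q = q[folded r_def]
      \<comment> \<open>The parent precedes \<open>v\<close> in the Prim order and therefore has not
        been processed yet.\<close>
      have rU: "r \<in> U" using q(1) p unfolding U_def r_def by simp
      moreover have "r \<noteq> v" using inj_onD[OF inj, of q p] q(1) p(1) unfolding r_def v_def by auto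
      ultimately have rU: "r \<in> U" "r < n" "r \<noteq> v" using Un by auto
      note step = inv_keep_step[OF inv Un vU(1) rU(1,3) q(4,5,3)]
        inv_emit_step[OF inv Un vU(1) rU(1,3) q(4,5,3)]
        merge_step_bag(1)[OF inv Un vU(1) rU(1,3) q(4,5,3)]
      let ?\<sigma> = "merge_bags r v \<sigma>"
      \<comment> \<open>The merged walk has one entry more than its two parts together. The summand
        \<open>card U\<close>, which is positive, leaves room for it in the budget.\<close>
      have lenm: "length (bag_walk ?\<sigma> r) \<le> 2 * n"
      proof -
        have "sum (\<lambda>u. length (bag_walk \<sigma> u)) {r, v} \<le> sum (\<lambda>u. length (bag_walk \<sigma> u)) U"
          by (rule sum_mono2) (use fin rU vU in auto)
        moreover have "0 < card U" using fin vU card_gt_0_iff by blast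
        ultimately show ?thesis using inv rU(3) by (simp add: bag_inv_def merge_bags_def)
      qed
      have E: "runs ?E t2 (Suc (12 + 20 * n))
        (\<lambda>s'. nmem s' (6, 0, 0) = i \<and> ?Q (Suc i) (set_nat 6 0 0 (Suc i) s'))"
        if t2: "rmem t2 = rmem t1" "\<And>a b c. a \<notin> {6, 11, 12, 13, 14} \<or> (a = 6 \<and> b \<notin> {1, 4}) \<Longrightarrow>
            nmem t2 (a, b, c) = nmem t1 (a, b, c)"
          "nmem t2 (6, 4, 0) = r" "\<And>j. j < n \<Longrightarrow> represents n ?\<sigma> t2 j" for t2
      proof -
        have m2: "nmem t2 (6, 3, 0) = v" "nmem t2 (0, 0, 0) = n" "nmem t2 (0, 0, 2) = k"
          "nmem t2 (7, v, 0) = Suc r" "nmem t2 (11, r, 0) = bag_load ?\<sigma> r"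
          "\<And>i. nmem t2 (10, i, 0) = nd i" "\<And>i. rmem t2 (1, i, 0) = dd i"
          using t2 mt q(2) t2(4)[OF rU(2)] by (auto simp: t1_def represents_def)
        show ?thesis
        proof (rule runs_Cond)
          assume "bval (BAnd (NLess (NConst 0) (Arr 7 (Var 3)))
             (BNot (NLess cap (NAdd (Arr 11 (Var 4)) (Arr 11 (Var 4)))))) t2"
          then have load: "2 * bag_load ?\<sigma> r \<le> k" using m2 t2(3) by simp
          show "runs keep_com t2 (12 + 20 * n)
            (\<lambda>s'. nmem s' (6, 0, 0) = i \<and> ?Q (Suc i) (set_nat 6 0 0 (Suc i) s'))"
          proof (rule runs_mono[OF runs_keep[where v = v and n = n and \<sigma> = ?\<sigma>]], goal_cases)
            case (5 s')
            have f: "rmem s' = rmem t" using 5 t2(1) by (simp add: t1_def)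
            have "nmem s' (a, b, c) = nmem t (a, b, c)"
              if "a \<notin> {3, 4, 5, 6, 11, 12, 13, 14} \<or> (a = 6 \<and> b = 0)" for a b c
            proof -
              have "nmem s' (a, b, c) = nmem t2 (a, b, c)" using 5 that by auto
              also have "\<dots> = nmem t1 (a, b, c)" using that by (intro t2(2)) auto
              finally show ?thesis using that by (auto simp: t1_def)
            qed
            moreover have "\<And>j. j < n \<Longrightarrow> represents n (keep_bag n v ?\<sigma>) s' j" using 5 by blast
            ultimately show ?case by (rule goal[OF f _ step(1)[OF load]])
          qed (use m2 t2 in auto)
        next
          assume "\<not> bval (BAnd (NLess (NConst 0) (Arr 7 (Var 3)))
             (BNot (NLess cap (NAdd (Arr 11 (Var 4)) (Arr 11 (Var 4)))))) t2"
          then have load: "k < 2 * bag_load ?\<sigma> r" using m2 t2(3) by simp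
          show "runs emit_com t2 (12 + 20 * n)
            (\<lambda>s'. nmem s' (6, 0, 0) = i \<and> ?Q (Suc i) (set_nat 6 0 0 (Suc i) s'))"
          proof (rule runs_mono[OF runs_emit[where v = v and r = r and n = n and \<sigma> = ?\<sigma>]], goal_cases)
            case (10 s')
            then obtain x where x: "best x (bag_walk ?\<sigma> r)"
              "\<And>j. j < n \<Longrightarrow> represents n (emit_bag nd x r v ?\<sigma>) s' j"
              unfolding best using m2(6,7) by auto
            have f: "rmem s' = rmem t" using 10 t2(1) by (simp add: t1_def)
            have "nmem s' (a, b, c) = nmem t (a, b, c)"
              if "a \<notin> {3, 4, 5, 6, 11, 12, 13, 14} \<or> (a = 6 \<and> b = 0)" for a b c
            proof -
              have "nmem s' (a, b, c) = nmem t2 (a, b, c)" using 10 that by auto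
              also have "\<dots> = nmem t1 (a, b, c)" using that by (intro t2(2)) auto
              finally show ?thesis using that by (auto simp: t1_def)
            qed
            then show ?case by (rule goal[OF f _ step(2)[OF load x(1)] x(2)])
          qed (use m2 t2 vU rU step(3) lenm in \<open>auto simp: bag_ok_def closed_walk_def\<close>)
        qed
      qed
      have "runs ?M t1 (Suc (8 + 9 * n)) (\<lambda>s'. runs ?E s' (Suc (12 + 20 * n))
        (\<lambda>s'. nmem s' (6, 0, 0) = i \<and> ?Q (Suc i) (set_nat 6 0 0 (Suc i) s')))"
      proof (rule runs_Cond)
        show "runs merge_com t1 (8 + 9 * n) (\<lambda>s'. runs ?E s' (Suc (12 + 20 * n))
          (\<lambda>s'. nmem s' (6, 0, 0) = i \<and> ?Q (Suc i) (set_nat 6 0 0 (Suc i) s')))"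
        proof (rule runs_mono[OF runs_merge[where v = v and r = r and n = n and \<sigma> = \<sigma>]], goal_cases)
          case (9 s')
          then show ?case by (intro E) auto
        qed (use rep mt vU rU q(2) len[OF vU(1)] in \<open>auto simp: t1_def\<close>)
      qed (use q(2) mt(3) in \<open>simp add: t1_def\<close>)
      then show ?thesis by (rule runs_Seq)
    qed
    moreover have "nmem t (9, n - i - 1, 0) = v" using mt(4) by (simp add: p_def)
    ultimately show "runs (SetVar 3 (Arr 9 (NSub (NSub num_customers (Var 0)) (NConst 1))) ;; ?M ;; ?E) t ?T
      (\<lambda>s'. nmem s' (6, 0, 0) = i \<and> ?Q (Suc i) (set_nat 6 0 0 (Suc i) s'))"
      by (intro runs_Seq_NAssign) (use mt(1) t in \<open>simp add: t1_def\<close>)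
  next
    fix i t assume "?Q i t"
    then show "nval num_customers t = n" using io by (simp add: input_ok_def)
  qed
  then show ?thesis
    by (rule runs_mono) (use io in \<open>auto simp: algebra_simps input_ok_def\<close>)
qed

section \<open>Correctness for presented instances\<close>

lemma prim_order_bij:
  assumes "prim_inv n k d w dd n ord par key"
  shows "bij_betw ord {..<n} {..<n}"
  using assms endo_inj_surj[of "{..<n}" ord] by (simp add: prim_inv_def bij_betw_def)

lemma prim_parent:
  assumes inv: "prim_inv n k d w dd n ord par key" and s: "s < n"
  shows "par (ord s) = 0 \<and> key (ord s) = dd (ord s) \<or>
      (\<exists>r<s. par (ord s) = Suc (ord r) \<and> key (ord s) = w (ord r) (ord s) \<and>
        2 * d (ord r) \<le> k \<and> 2 * d (ord s) \<le> k)"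
proof -
  have "ord s < n" using prim_order_bij[OF inv] s by (auto simp: bij_betw_def)
  note inv[unfolded prim_inv_def, THEN conjunct2, THEN conjunct2, THEN conjunct1, rule_format, OF this]
  then show ?thesis using s by blast
qed

text \<open>Greedy bounds survive the removal of large customers from the order: what stands at or
  behind \<open>x\<close> was unvisited when \<open>x\<close> was selected, what stands in
  \<open>pre\<close> was visited earlier, and all of them are small, so the edges between them are
  admissible.\<close>

lemma prim_greedy:
  assumes inv: "prim_inv n k d w dd n ord par key"
    and split: "filter (\<lambda>x. 2 * d x \<le> k) (map ord [0..<n]) = pre @ x # post"
    and y: "y \<in> set (x # post)"
  shows "key x \<le> dd y" "r \<in> set pre \<Longrightarrow> key x \<le> w r y"
proof -
  define ts where "ts = filter (\<lambda>t. 2 * d (ord t) \<le> k) [0..<n]"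
  have "map ord ts = pre @ x # post" using split by (simp add: ts_def filter_map comp_def)
  then obtain a s b where ts: "ts = a @ s # b" "pre = map ord a" "x = ord s" "post = map ord b"
    by (auto simp: map_eq_append_conv map_eq_Cons_conv)
  have "sorted_wrt (<) ts" unfolding ts_def by (intro sorted_wrt_filter) simp
  then have lt: "\<And>t. t \<in> set b \<Longrightarrow> s < t" "\<And>r. r \<in> set a \<Longrightarrow> r < s"
    by (auto simp: ts(1) sorted_wrt_append)
  have sub: "\<And>t. t \<in> set ts \<Longrightarrow> t < n \<and> 2 * d (ord t) \<le> k" by (auto simp: ts_def)
  obtain t where t: "y = ord t" "t \<in> set (s # b)" using y ts by auto
  have tn: "t < n" "s \<le> t" "s < n" "2 * d (ord t) \<le> k"
    using t(2) lt(1)[of t] sub[of t] sub[of s] by (auto simp: ts(1))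
  have bij: "bij_betw ord {..<n} {..<n}" by (rule prim_order_bij[OF inv])
  have "ord t < n" using bij tn(1) by (auto simp: bij_betw_def)
  moreover have "ord t \<notin> ord ` {..<s}"
    using bij tn by (intro inj_on_notin_image_lessThan) (auto simp: bij_betw_def)
  moreover note inv[unfolded prim_inv_def, THEN conjunct2, THEN conjunct2, THEN conjunct2,
      THEN conjunct2, rule_format, OF tn(3)]
  ultimately have *: "key (ord s) \<le> dd (ord t)"
    "\<And>r. r < s \<Longrightarrow> 2 * d (ord r) \<le> k \<Longrightarrow> key (ord s) \<le> w (ord r) (ord t)"
    using tn(4) by blast+
  show "key x \<le> dd y" using * ts t by simp
  show "key x \<le> w r y" if r: "r \<in> set pre"
  proof -
    obtain r' where "r = ord r'" "r' \<in> set a" using r ts(2) by auto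
    then show ?thesis using *(2)[of r'] lt(2)[of r'] sub[of r'] ts t by (auto simp: ts(1))
  qed
qed

text \<open>\<open>edges_weight\<close> chooses the weight of an undirected edge by a description
  over both orientations; their agreement is what makes the choice unique.\<close>

lemma edge_weight_doubleton:
  assumes "c x y = c y x"
  shows "(THE r. \<exists>a b. {x, y} = {a, b} \<and> r = c a b) = c x y"
  by (rule the_equality) (use assms in \<open>auto simp: doubleton_eq_iff\<close>)

lemma walk_cost_eq_wcost: "walk_cost I p = wcost (weight I) p"
proof (induction "weight I" p rule: wcost.induct)
  case (1 x y zs)
  have "walk_cost I (x # y # zs) = weight I x y + walk_cost I (y # zs)"
    unfolding walk_cost_def by (simp add: sum.lessThan_Suc_shift del: sum.lessThan_Suc)
  then show ?case using 1 by simp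
qed (auto simp: walk_cost_def)

lemma wcost_map: "wcost w (map f l) = wcost (\<lambda>i j. w (f i) (f j)) l"
  by (induction "\<lambda>i j. w (f i) (f j)" l rule: wcost.induct) auto

section \<open>Instances numbered by a presentation\<close>

locale presented_instance =
  fixes I :: "'v mcvrp" and vs ds :: "'v list"
  assumes inst: "mcvrp_instance I" and demand_le: "\<And>v. v \<in> customers I \<Longrightarrow> demand I v \<le> capacity I"
    and pres: "presentation I vs ds"
begin

abbreviation "n \<equiv> length vs"
abbreviation "m \<equiv> length ds"
abbreviation "k \<equiv> capacity I"

definition d :: "nat \<Rightarrow> nat" where "d i = demand I (vs ! i)"
definition w :: "nat \<Rightarrow> nat \<Rightarrow> real" where "w i j = weight I ((vs @ ds) ! i) ((vs @ ds) ! j)"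
definition dd :: "nat \<Rightarrow> real" where "dd i = depot_dist I (vs ! i)"

lemma presentation_facts:
  "distinct vs" "set vs = customers I" "distinct ds" "set ds = depots I" "distinct (vs @ ds)"
  "set (vs @ ds) = vertices I" "0 < m"
  using pres inst by (auto simp: presentation_def mcvrp_instance_def)

lemma nth_vertices: "i < n + m \<Longrightarrow> (vs @ ds) ! i \<in> vertices I"
  using presentation_facts(6) nth_mem[of i "vs @ ds"] by simp

lemma w_sym: "i < n + m \<Longrightarrow> j < n + m \<Longrightarrow> w i j = w j i"
  using inst nth_vertices unfolding mcvrp_instance_def w_def by blast

lemma w_nonneg: "i < n + m \<Longrightarrow> j < n + m \<Longrightarrow> 0 \<le> w i j"
  using inst nth_vertices unfolding mcvrp_instance_def w_def by blast

lemma nearest_dd: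
  assumes "nearest_ok n m w s i" "i < n"
  shows "rmem s (1, i, 0) = dd i"
proof -
  have img: "(\<lambda>u. weight I u (vs ! i)) ` depots I = (\<lambda>u. w (n + u) i) ` {..<m}"
    using assms(2) unfolding presentation_facts(4)[symmetric] set_conv_nth
    by (auto simp: w_def nth_append)
  have "rmem s (1, i, 0) \<in> (\<lambda>u. w (n + u) i) ` {..<m}"
    using assms(1) by (intro image_eqI[of _ _ "nmem s (10, i, 0) - n"]) (auto simp: nearest_ok_def)
  then show ?thesis
    unfolding dd_def depot_dist_def img
    using assms(1) by (intro Min_eqI[symmetric]) (auto simp: nearest_ok_def)
qed

lemma dd_nonneg: "i < n \<Longrightarrow> 0 \<le> dd i"
  unfolding dd_def depot_dist_def using inst presentation_facts(2) nth_mem[of i vs]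
  by (subst Min_ge_iff) (auto simp: mcvrp_instance_def)

lemma sum_customers: "(\<Sum>v\<in>customers I. g v) = (\<Sum>i<n. g (vs ! i))"
  for g :: "'v \<Rightarrow> 'b :: comm_monoid_add"
proof -
  have "customers I = (!) vs ` {..<n}"
    using presentation_facts(2) by (auto simp: set_conv_nth)
  then show ?thesis
    using presentation_facts(1) by (simp add: sum.reindex inj_on_nth)
qed

lemma Delta_eq: "Delta I = (\<Sum>j<n. real (d j) * dd j)"
  by (simp add: Delta_def sum_customers d_def dd_def)

text \<open>This is \<open>greedy_sum_le_connecting_weight\<close> for the visited set
  \<open>{None}\<close> and the small customers in Prim order. \<open>prim_greedy\<close> supplies
  the comparison with each edge, separately for the two terms of the minimum in
  \<open>aux_weight\<close>.\<close>

lemma sum_key_le_spanning_tree: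
  assumes inv: "prim_inv n k d w dd n ord par key" and T: "small_min_spanning_tree I T"
  shows "(\<Sum>t | t < n \<and> 2 * d t \<le> k. key t) \<le> edges_weight (aux_weight I) T"
proof -
  define g where "g = (\<lambda>i. Some (vs ! i))"
  \<comment> \<open>The greedy bound sums over vertices of \<open>H\<close>, whereas keys are
    indexed by positions; the inverse of the injective numbering \<open>g\<close> transports
    them.\<close>
  define f where "f = (\<lambda>y. key (the_inv_into {..<n} g y))"
  define os where "os = filter (\<lambda>x. 2 * d x \<le> k) (map ord [0..<n])"
  define c where "c = (\<lambda>e. THE r. \<exists>x y. e = {x, y} \<and> r = aux_weight I x y)"
  have inj: "inj_on g {..<n}"
    using presentation_facts(1) by (auto simp: g_def inj_on_def nth_eq_iff_index_eq)
  have bij: "bij_betw ord {..<n} {..<n}" by (rule prim_order_bij[OF inv])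
  have os: "distinct os" "set os = {t. t < n \<and> 2 * d t \<le> k}"
  proof -
    have "set (map ord [0..<n]) = {..<n}" using bij by (simp add: bij_betw_def lessThan_atLeast0)
    then show "set os = {t. t < n \<and> 2 * d t \<le> k}" unfolding os_def by auto
    show "distinct os"
      using bij by (auto simp: os_def distinct_map bij_betw_def lessThan_atLeast0)
  qed
  have f: "f (g i) = key i" if "i < n" for i
    using the_inv_into_f_f[OF inj] that by (simp add: f_def)
  define S where "S = insert None (Some ` small_customers I)"
  have gos: "g ` set os = Some ` small_customers I"
    unfolding os(2) small_customers_def presentation_facts(2)[symmetric] g_def d_def
    by (auto simp: set_conv_nth image_iff) 
  have T': "T \<subseteq> induced_edges (aux_edges I) S" "graph_connected S T"
    using T unfolding small_min_spanning_tree_def S_def Let_def min_spanning_tree_def spanning_tree_def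
    by auto
  have TS: "e \<subseteq> S" if "e \<in> T" for e using T'(1) that by (auto simp: induced_edges_def)
  have finS: "finite S"
    using inst by (auto simp: S_def small_customers_def mcvrp_instance_def)
  then have finT: "finite T" using TS finite_subset[of T "Pow S"] by auto
  have idx: "y = None \<or> (\<exists>i\<in>set os. y = g i)" if "y \<in> S" for y
    using that gos unfolding S_def by blast
  have aux_None: "aux_weight I (g i) None = dd i" "aux_weight I None (g i) = dd i" for i
    by (simp_all add: g_def dd_def)
  have aux_Some: "aux_weight I (g i) (g j) = min (dd i + dd j) (w i j)" if "i < n" "j < n" for i j
    using that by (simp add: g_def dd_def w_def nth_append)
  have sym: "aux_weight I x y = aux_weight I y x" if "x \<in> S" "y \<in> S" for x y
    using idx[OF that(1)] idx[OF that(2)]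
    by (elim disjE bexE) (simp_all add: aux_None aux_Some os(2) w_sym add.commute)
  have cxy: "c {x, y} = aux_weight I x y" if "{x, y} \<in> T" for x y
    unfolding c_def using TS[OF that] sym by (intro edge_weight_doubleton) auto
  have c_nonneg: "0 \<le> c e" if e: "e \<in> T" for e
  proof -
    obtain x y where xy: "e = {x, y}"
      using T'(1) e by (auto simp: induced_edges_def aux_edges_def)
    have "0 \<le> aux_weight I x y"
    proof -
      have "x \<in> S" "y \<in> S" using TS[OF e] xy by auto
      from idx[OF this(1)] idx[OF this(2)] show ?thesis
        by (elim disjE bexE) (simp_all add: aux_None aux_Some os(2) dd_nonneg w_nonneg)
    qed
    then show ?thesis using cxy e xy by simp
  qed
  have "(\<Sum>x\<in>set (map g os). f x) \<le> (\<Sum>e\<in>T. c e)"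
  proof (rule greedy_sum_le_connecting_weight[where A = "{None}"])
    show "distinct (map g os)"
      using os inj inj_on_subset[OF inj, of "set os"] by (auto simp: distinct_map)
    show "e \<subseteq> {None} \<union> set (map g os)" if "e \<in> T" for e
      using TS[OF that] gos by (auto simp: S_def)
    show "\<exists>a\<in>{None}. (x, a) \<in> (adj T)\<^sup>*" if "x \<in> set (map g os)" for x
      using T'(2) that gos unfolding graph_connected_def adj_def S_def by auto
    show "f x \<le> c {y, y'}" if split: "map g os = pre @ x # post" and y: "y \<in> set (x # post)"
      and y': "y' \<in> {None} \<union> set pre" and e: "{y, y'} \<in> T" for pre x post y y'
    proof -
      obtain pre' x' post' where s: "os = pre' @ x' # post'" "pre = map g pre'" "x = g x'"
        "post = map g post'"
        using split by (auto simp: map_eq_append_conv map_eq_Cons_conv)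
      obtain i where i: "y = g i" "i \<in> set (x' # post')" using y s by auto
      have n: "x' < n" "i < n" "\<And>r. r \<in> set pre' \<Longrightarrow> r < n"
        using os(2) s(1) i(2) by auto
      note greedy = prim_greedy[OF inv s(1)[unfolded os_def] i(2)]
      show ?thesis
      proof (cases y')
        case None
        then show ?thesis using greedy(1) cxy[OF e] i(1) f n aux_None s(3) by simp
      next
        case (Some v)
        then obtain r where r: "y' = g r" "r \<in> set pre'" using y' s by auto
        have "key x' \<le> w i r" using greedy(2)[OF r(2)] w_sym[of i r] n(2) n(3)[OF r(2)] by simp
        moreover have "key x' \<le> dd i + dd r" using greedy(1) dd_nonneg[OF n(3)[OF r(2)]] by simp
        ultimately show ?thesis
          using cxy[OF e] aux_Some[of i r] i(1) r n(2) n(3)[OF r(2)] f[OF n(1)] s(3) by simp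
      qed
    qed
  qed (use finT c_nonneg in \<open>auto simp: g_def\<close>)
  moreover have "(\<Sum>x\<in>set (map g os). f x) = (\<Sum>t | t < n \<and> 2 * d t \<le> k. key t)"
  proof -
    have "(\<Sum>x\<in>g ` set os. f x) = (\<Sum>i\<in>set os. f (g i))"
      using inj_on_subset[OF inj, of "set os"] os(2) by (subst sum.reindex) auto
    also have "\<dots> = (\<Sum>i\<in>set os. key i)" using f os(2) by (intro sum.cong) auto
    finally show ?thesis using os(2) by simp
  qed
  ultimately show ?thesis by (simp add: edges_weight_def c_def)
qed

section \<open>Tours over the original vertices\<close>

definition solution :: "bags \<Rightarrow> 'v tour list" where
  "solution \<sigma> = map (\<lambda>t. \<lparr>walk = map ((!) (vs @ ds)) (tour_walk \<sigma> t),
     deliver = (\<lambda>x. \<Sum>i<n. if vs ! i = x then tour_units \<sigma> t i else 0)\<rparr>) [0..<n]"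

text \<open>Deliveries are functions on vertices, while the units are indexed by positions. As the
  presentation is distinct, at most one summand belongs to a given vertex.\<close>

lemma deliver_nth:
  "i < n \<Longrightarrow> (\<Sum>j<n. if vs ! j = vs ! i then y j else 0) = (y i :: nat)"
proof -
  assume i: "i < n"
  have "(\<Sum>j<n. if vs ! j = vs ! i then y j else 0) = (\<Sum>j<n. if j = i then y j else 0)"
    using presentation_facts(1) i by (intro sum.cong) (auto simp: nth_eq_iff_index_eq)
  then show ?thesis using i by simp
qed

lemma is_tour_solution:
  assumes ok: "tour_ok n m k l y"
  shows "is_tour I \<lparr>walk = map ((!) (vs @ ds)) l,
    deliver = (\<lambda>x. \<Sum>i<n. if vs ! i = x then y i else 0)\<rparr>"
proof -
  have l: "l \<noteq> []" "n \<le> hd l" "hd l < n + m" "last l = hd l" "set l \<subseteq> {..<n} \<union> {hd l}"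
    "successively (\<noteq>) l" "\<And>j. j < n \<Longrightarrow> y j \<noteq> 0 \<Longrightarrow> j \<in> set l" "(\<Sum>j<n. y j) \<le> k"
    using ok by (auto simp: tour_ok_def)
  have cust: "(vs @ ds) ! i \<in> customers I" if "i < n" for i
    using nth_mem[OF that] presentation_facts(2) that by (simp add: nth_append)
  have "hd l - n < m" using l(2,3) by linarith
  then have "(vs @ ds) ! hd l \<in> depots I"
    using l(2) nth_mem[of "hd l - n" ds] presentation_facts(4) by (simp add: nth_append)
  moreover have "successively (\<noteq>) (map ((!) (vs @ ds)) l)"
    unfolding successively_map
  proof (rule successively_mono[OF l(6)])
    fix a b assume ab: "a \<in> set l" "b \<in> set l" "a \<noteq> b"
    have "a < length (vs @ ds)" "b < length (vs @ ds)" using ab(1,2) l(3,5) by auto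
    then show "(vs @ ds) ! a \<noteq> (vs @ ds) ! b"
      using nth_eq_iff_index_eq[OF presentation_facts(5)] ab(3) by blast
  qed
  moreover have "v \<in> customers I \<and> v \<in> (!) (vs @ ds) ` set l"
    if v: "(\<Sum>i<n. if vs ! i = v then y i else 0) \<noteq> 0" for v
  proof -
    obtain i where i: "i < n" "(if vs ! i = v then y i else 0) \<noteq> 0"
      using sum.not_neutral_contains_not_neutral[OF v] by auto
    then have iv: "vs ! i = v" "y i \<noteq> 0" by (metis, metis)
    have "(vs @ ds) ! i = v" using i(1) iv(1) by (simp add: nth_append)
    then show ?thesis using l(7)[OF i(1) iv(2)] cust[OF i(1)] by blast
  qed
  moreover have "set (map ((!) (vs @ ds)) l) \<subseteq> customers I \<union> {(vs @ ds) ! hd l}"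
    using l(5) cust by auto
  moreover have "(\<Sum>v\<in>customers I. \<Sum>i<n. if vs ! i = v then y i else 0) = (\<Sum>j<n. y j)"
    unfolding sum_customers by (intro sum.cong) (auto simp: deliver_nth)
  ultimately show ?thesis
    using l(1,4,8) unfolding is_tour_def by (simp add: hd_map last_map)
qed

text \<open>The owner map settles both demands at once: summed over all slots, a customer receives
  its demand from its owner alone, and that tour is the witness for unsplit delivery.\<close>

lemma feasible_solution:
  assumes ok: "\<And>t. t < n \<Longrightarrow> tour_ok n m k (tour_walk \<sigma> t) (tour_units \<sigma> t)"
    and own: "\<And>j. j < n \<Longrightarrow> own j < n"
      "\<And>i j. i < n \<Longrightarrow> j < n \<Longrightarrow> tour_units \<sigma> i j = (if i = own j then d j else 0)"
  shows "feasible \<nu> I (solution \<sigma>)"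
  unfolding feasible_def
proof (intro conjI impI ballI)
  show "is_tour I \<tau>" if "\<tau> \<in> set (solution \<sigma>)" for \<tau>
    using that is_tour_solution[OF ok] by (auto simp: solution_def)
  fix v assume "v \<in> customers I"
  then obtain j where j: "j < n" "v = vs ! j"
    using presentation_facts(2) by (metis in_set_conv_nth)
  have "(\<Sum>\<tau>\<leftarrow>solution \<sigma>. deliver \<tau> v) = (\<Sum>t<n. tour_units \<sigma> t j)"
    using j by (simp add: solution_def comp_def deliver_nth interv_sum_list_conv_sum_set_nat atLeast0LessThan)
  also have "\<dots> = (\<Sum>t<n. if t = own j then d j else 0)"
    using own j by (intro sum.cong) auto
  also have "\<dots> = demand I v" using own j by (simp add: d_def)
  finally show "(\<Sum>\<tau>\<leftarrow>solution \<sigma>. deliver \<tau> v) = demand I v" .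
  show "\<exists>\<tau>\<in>set (solution \<sigma>). deliver \<tau> v = demand I v"
    using own j deliver_nth[OF j(1), of "tour_units \<sigma> (own j)"]
    by (auto simp: solution_def d_def intro!: bexI[of _ "own j"])
qed

lemma solution_cost_eq: "solution_cost I (solution \<sigma>) = (\<Sum>t<n. wcost w (tour_walk \<sigma> t))"
  by (simp add: solution_cost_def solution_def comp_def walk_cost_eq_wcost wcost_map w_def[abs_def]
      interv_sum_list_conv_sum_set_nat atLeast0LessThan)

lemma outputs_solution:
  assumes rep: "\<And>i. i < n \<Longrightarrow> represents n \<sigma> s i" and n: "nmem s (2, 0, 0) = n"
    and ok: "\<And>t. t < n \<Longrightarrow> tour_ok n m k (tour_walk \<sigma> t) (tour_units \<sigma> t)"
  shows "outputs s vs ds (solution \<sigma>)"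
proof -
  have "tour_walk \<sigma> t ! q < n + m" if "t < n" "q < length (tour_walk \<sigma> t)" for t q
    using ok[OF that(1)] nth_mem[OF that(2)] by (auto simp: tour_ok_def)
  then show ?thesis
    using rep n unfolding outputs_def
    by (auto simp: solution_def represents_def deliver_nth)
qed

lemma input_state_ok:
  "input_ok n m k d w (input_state I vs ds)" "blank (input_state I vs ds)"
  "nmem (input_state I vs ds) (14, i, j) = 0"
  by (simp_all add: input_ok_def blank_def input_state_def d_def w_def)

lemma runs_vrp:
  "runs vrp_com (input_state I vs ds)
     ((2 + n * (11 + m * 5)) + ((2 + n * (9 + n * 9)) + ((2 + n * (25 + 29 * n)) + 1)))
     (\<lambda>s. \<exists>sol. outputs s vs ds sol \<and> feasible \<nu> I sol \<and>
        (\<forall>T. small_min_spanning_tree I T \<longrightarrow> solution_cost I sol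
           \<le> 2 / (real (k div 2) + 1) * Delta I + 2 * edges_weight (aux_weight I) T))"
    (is "runs _ _ _ ?P")
  unfolding vrp_com_def
proof (rule runs_Seq, rule runs_mono[OF runs_init[OF input_state_ok(1) presentation_facts(7) input_state_ok(2,3)]],
    goal_cases)
  case (2 s1)
  then have s1: "input_ok n m k d w s1" "blank s1" "\<And>i. i < n \<Longrightarrow> nearest_ok n m w s1 i \<and>
      rmem s1 (2, i, 0) = rmem s1 (1, i, 0) \<and> represents n (initial_bags d) s1 i" by auto
  show ?case
  proof (rule runs_Seq, rule runs_mono[OF runs_prim[OF s1]], goal_cases)
    case (3 s2)
    define dd' where "dd' = (\<lambda>x. rmem s2 (1, x, 0))"
    define nd where "nd = (\<lambda>x. nmem s2 (10, x, 0))"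
    define ord where "ord = (\<lambda>t. nmem s2 (9, t, 0))"
    define par where "par = (\<lambda>x. nmem s2 (7, x, 0))"
    define key where "key = (\<lambda>x. rmem s2 (2, x, 0))"
    have near: "\<And>i. i < n \<Longrightarrow> nearest_ok n m w s2 i" using 3 by blast
    have dd': "dd' i = dd i" if "i < n" for i
      using nearest_dd[OF near] that by (simp add: dd'_def)
    have prim': "prim_inv n k d w dd' n ord par key"
      using 3 unfolding dd'_def ord_def par_def key_def by blast
    interpret bag_setup n m k d w dd' nd ord par key
    proof
      show "d i \<le> k" if "i < n" for i
        using demand_le[of "vs ! i"] presentation_facts(2) nth_mem[OF that] by (simp add: d_def)
      show "n \<le> nd i \<and> nd i < n + m \<and> w (nd i) i = dd' i" if "i < n" for i
        using near[OF that] by (simp add: nearest_ok_def nd_def dd'_def)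
    qed (use w_sym dd_nonneg dd' presentation_facts(7) prim_order_bij[OF prim'] prim_parent[OF prim'] in auto)
    \<comment> \<open>The distances in memory agree with \<open>dd\<close> below \<open>n\<close>,
      and the invariant evaluates them only there.\<close>
    have prim: "prim_inv n k d w dd n ord par key"
      using prim' dd' unfolding prim_inv_def by (simp cong: conj_cong)
    show ?case
    proof (rule runs_Seq, rule runs_mono[OF runs_bag], goal_cases)
      case (8 s3)
      then obtain \<sigma> where \<sigma>: "bag_inv {} \<sigma>" "\<forall>i<n. represents n \<sigma> s3 i" by blast
      note fin = inv_final[OF \<sigma>(1)]
      obtain own where own: "\<And>j. j < n \<Longrightarrow> own j < n"
        "\<And>i j. i < n \<Longrightarrow> j < n \<Longrightarrow> tour_units \<sigma> i j = (if i = own j then d j else 0)"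
        using fin(2) by blast
      have "outputs (set_nat 2 0 0 n s3) vs ds (solution \<sigma>)"
        using \<sigma>(2) fin(1) by (intro outputs_solution) (auto simp: represents_def)
      moreover have "feasible \<nu> I (solution \<sigma>)"
        by (rule feasible_solution[OF fin(1) own])
      moreover have "solution_cost I (solution \<sigma>)
          \<le> 2 / (real (k div 2) + 1) * Delta I + 2 * edges_weight (aux_weight I) T"
        if "small_min_spanning_tree I T" for T
      proof -
        have "(\<Sum>j<n. real (d j) * dd' j) = Delta I"
          unfolding Delta_eq using dd' by (intro sum.cong) auto
        then show ?thesis
          using fin(3) sum_key_le_spanning_tree[OF prim that]
          by (simp add: solution_cost_eq alpha_def)
      qed
      ultimately have "?P (set_nat 2 0 0 n s3)" by blast
      then show ?case using 8 by (intro runs_NAssign) simp_all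
    qed (use 3 in \<open>auto simp: par_def ord_def nd_def dd'_def\<close>)
  qed auto
qed auto

lemma card_vertices: "card (vertices I) = n + m"
  using distinct_card[OF presentation_facts(5)] presentation_facts(6) by simp

text \<open>The squared number of vertices in the instance size dominates both \<open>n\<close> and
  \<open>m\<close>. Replacing them by it, the coefficients add up to \<open>2 + 2 + 2 + 1\<close>,
  \<open>11 + 9 + 25\<close> and \<open>5 + 9 + 29\<close>.\<close>

lemma time_le_poly:
  "(2 + n * (11 + m * 5)) + ((2 + n * (9 + n * 9)) + ((2 + n * (25 + 29 * n)) + 1))
    \<le> poly [:7, 45, 43:] (instance_size I)"
proof -
  define z where "z = instance_size I"
  have "n + m \<le> (n + m)\<^sup>2" unfolding power2_eq_square by (rule le_square)
  also have "\<dots> \<le> z" unfolding z_def instance_size_def card_vertices by simp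
  finally have z: "n \<le> z" "m \<le> z" by simp_all
  have "n * (11 + m * 5) \<le> z * (11 + z * 5)" "n * (9 + n * 9) \<le> z * (9 + z * 9)"
    "n * (25 + 29 * n) \<le> z * (25 + 29 * z)"
    by (rule mult_le_mono[OF z(1)]; use z in simp)+
  then show ?thesis unfolding z_def[symmetric] by (simp add: algebra_simps)
qed

end

theorem theorem1:
  fixes \<nu> :: problem_variant
  shows "\<exists>(P :: com) (p :: nat poly).
    \<forall>(I :: 'v mcvrp) vs ds.
      variant_instance \<nu> I \<and> (\<forall>v\<in>customers I. demand I v \<le> capacity I) \<and>
      presentation I vs ds \<longrightarrow>
      (\<exists>t s sol.
         exec P (input_state I vs ds) t s \<and>
         t \<le> poly p (instance_size I) \<and>
         outputs s vs ds sol \<and>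
         feasible \<nu> I sol \<and>
         (\<forall>T. small_min_spanning_tree I T \<longrightarrow>
            solution_cost I sol
              \<le> 2 / (real (capacity I div 2) + 1) * Delta I
                + 2 * edges_weight (aux_weight I) T))"
\<comment> \<open>The witnesses do not depend on \<open>\<nu>\<close>: the same unsplit solution is
  feasible in every variant.\<close>
proof (intro exI[of _ vrp_com] exI[of _ "[:7, 45, 43:]"] allI impI, elim conjE)
  fix I :: "'v mcvrp" and vs ds
  assume "variant_instance \<nu> I" "\<forall>v\<in>customers I. demand I v \<le> capacity I" "presentation I vs ds"
  then interpret presented_instance I vs ds
    by unfold_locales (auto simp: variant_instance_def)
  from runs_vrp[of \<nu>] show "\<exists>t s sol. exec vrp_com (input_state I vs ds) t s \<and>
         t \<le> poly [:7, 45, 43:] (instance_size I) \<and>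
         outputs s vs ds sol \<and> feasible \<nu> I sol \<and>
         (\<forall>T. small_min_spanning_tree I T \<longrightarrow> solution_cost I sol
              \<le> 2 / (real (capacity I div 2) + 1) * Delta I
                + 2 * edges_weight (aux_weight I) T)"
    unfolding runs_def using time_le_poly le_trans by blast
qed

end
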